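(* Let $\mathcal H=\mathbb C_r^2\otimes\mathbb C_t^2$ (two qubits labelled $r$ and $t$), and for $\bm\theta=(\theta_1,\theta_2,\theta_3)^T\in\mathbb R^3$ let $\rho_{\bm\theta}=U_{\bm\theta}\,\rho_0\,U_{\bm\theta}^\dagger$, where $$\rho_0=|0\rangle\langle 0|_r\otimes\tfrac12\mathbb I_t,\qquad U_{\bm\theta}=\exp\!\Big[-\mathrm i\sqrt2\big(\theta_1\,\sigma_x^{(r)}\otimes\mathbb I_t+\theta_2\,\sigma_y^{(r)}\otimes\mathbb I_t+\theta_3\,\sigma_y^{(r)}\otimes\sigma_x^{(t)}\big)\Big].$$ For this model at the local point $\bm\theta=0$ with weight matrix $W=\mathbb I_3$, the normalized Nagaoka–Hayashi bounds $C_{\mathrm{NH}}^{(n)}$, the normalized finite-copy optima $C^{(n)}$ and the Holevo Cramér–Rao bound $C^{\mathrm H}$ satisfy $$C_{\mathrm{NH}}^{(1)}=C^{(1)}=\frac{3+2\sqrt2}{8},\qquad C_{\mathrm{NH}}^{(2)}=C^{(2)}=C^{\mathrm H}=\frac58 .$$ In particular, the strict one-copy gap between the Nagaoka–Hayashi and Holevo bounds closes at two copies.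
   Context: $\sigma_x,\sigma_y,\sigma_z$ are the Pauli matrices; superscripts $(r),(t)$ indicate the tensor factor acted on; $\mathbb I$ is the identity. General setting. Let $\rho_{\bm\theta}$ be a smooth $p$-parameter family of density operators on a finite-dimensional Hilbert space $\mathcal H$, with $\bm\theta=0$ an interior point of the parameter set. Put $\rho=\rho_{\bm 0}$ and $D_\mu=\partial_{\theta_\mu}\rho_{\bm\theta}|_{\bm\theta=0}$. For $n\ge1$ put $D_\mu^{(n)}=\partial_{\theta_\mu}\rho_{\bm\theta}^{\otimes n}|_{\bm\theta=0}$. $W$ is a real symmetric positive-definite $p\times p$ matrix. Finite-copy optimum. An $n$-copy estimator is a POVM $\mathcal M=\{M_k\}$ on $\mathcal H^{\otimes n}$ (finitely many outcomes; $M_k\ge0$, $\sum_kM_k=\mathbb I$) together with vectors $\widetilde{\bm\theta}(k)\in\mathbb R^p$. It is locally unbiased if $\sum_k\operatorname{Tr}(\rho^{\otimes n}M_k)\,\widetilde\theta_\mu(k)=0$ and $\sum_k\operatorname{Tr}(D^{(n)}_\nu M_k)\,\widetilde\theta_\mu(k)=\delta_{\mu\nu}$ for all $\mu,\nu$. Its mean-square error matrix is $V=\sum_k\operatorname{Tr}(\rho^{\otimes n}M_k)\,\widetilde{\bm\theta}(k)\widetilde{\bm\theta}(k)^T$. Then $$C^{(n)}(W)=n\min_{\mathcal M,\widetilde{\bm\theta}}\operatorname{Tr}(WV),$$ the minimum (understood as infimum) being over locally unbiased $n$-copy estimators. Holevo bound. $$C^{\mathrm H}(W)=\min_X\big\{\operatorname{Tr}[W\operatorname{Re}Z(X)]+\|\sqrt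 W\,\operatorname{Im}Z(X)\,\sqrt W\|_1\big\},$$ where $X=(X_1,\dots,X_p)$ ranges over tuples of Hermitian operators on $\mathcal H$ with $\operatorname{Tr}(\rho X_\mu)=0$ and $\operatorname{Tr}(D_\nu X_\mu)=\delta_{\mu\nu}$, $Z_{\mu\nu}(X)=\operatorname{Tr}(\rho X_\mu X_\nu)$, real and imaginary parts are entrywise, and $\|A\|_1=\operatorname{Tr}\sqrt{A^\dagger A}$. Nagaoka–Hayashi bound. For $n\ge1$, $$C_{\mathrm{NH}}^{(n)}(W)=n\min_{X,\mathbb L}\ \sum_{\mu,\nu=1}^pW_{\mu\nu}\operatorname{Tr}(\rho^{\otimes n}\,\mathbb L_{\mu\nu}),$$ the minimum (understood as infimum) being over tuples $X=(X_1,\dots,X_p)$ of Hermitian operators on $\mathcal H^{\otimes n}$ with $\operatorname{Tr}(\rho^{\otimes n}X_\mu)=0$ and $\operatorname{Tr}(D^{(n)}_\nu X_\mu)=\delta_{\mu\nu}$, and over $p\times p$ block operators $\mathbb L=(\mathbb L_{\mu\nu})$ on $\mathbb C^p\otimes\mathcal H^{\otimes n}$ whose blocks are Hermitian operators on $\mathcal H^{\otimes n}$ with $\mathbb L_{\mu\nu}=\mathbb L_{\nu\mu}$ and which satisfy $\mathbb L\ge (X_\mu X_\nu)_{\mu,\nu=1}^p$ as operators on $\mathbb C^p\otimes\mathcal H^{\otimes n}$. *)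

theory Defs
  imports "HOL-Analysis.Analysis"
begin

text \<open>An operator on the Hilbert space with orthonormal basis indexed by the finite type \<open>'h\<close>
  is a square complex matrix. Entries are \<open>A $ row $ column\<close>. Note that \<open>*\<close>, \<open>1\<close> and \<open>^\<close> on
  these matrices are entrywise, so only \<open>**\<close> and \<open>mat 1\<close> are used.\<close>

type_synonym 'h op = "complex^'h^'h"

subsection \<open>Linear algebra\<close>

definition cscale :: "complex \<Rightarrow> 'h::finite op \<Rightarrow> 'h op" where
  "cscale c A = (\<chi> i j. c * A $ i $ j)"

definition dagger :: "'h::finite op \<Rightarrow> 'h op" where
  "dagger A = (\<chi> i j. cnj (A $ j $ i))"

definition hermitian :: "'h::finite op \<Rightarrow> bool" where
  "hermitian A \<longleftrightarrow> dagger A = A"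

definition psd :: "'h::finite op \<Rightarrow> bool" where
  "psd A \<longleftrightarrow> hermitian A \<and> (\<forall>v. 0 \<le> Re (\<Sum>i\<in>UNIV. cnj (v $ i) * (A *v v) $ i))"

text \<open>The unique positive semidefinite square root (of a positive semidefinite operator).\<close>

definition op_sqrt :: "'h::finite op \<Rightarrow> 'h op" where
  "op_sqrt A = (THE B. psd B \<and> B ** B = A)"

definition trace_norm :: "'h::finite op \<Rightarrow> real" where
  "trace_norm A = Re (trace (op_sqrt (dagger A ** A)))"

definition op_power :: "'h::finite op \<Rightarrow> nat \<Rightarrow> 'h op" where
  "op_power A k = (((**) A) ^^ k) (mat 1)"

definition op_exp :: "'h::finite op \<Rightarrow> 'h op" where
  "op_exp A = (\<Sum>k. (1 / fact k) *\<^sub>R op_power A k)"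

definition tensor_op :: "'a::finite op \<Rightarrow> 'b::finite op \<Rightarrow> ('a \<times> 'b) op" (infixr "\<otimes>\<^sub>o" 75) where
  "A \<otimes>\<^sub>o B = (\<chi> i j. A $ fst i $ fst j * B $ snd i $ snd j)"

text \<open>The basis of the \<open>n\<close>-fold tensor power consists of the \<open>n\<close>-tuples of basis indices. The copies
  are labelled by a finite type \<open>'k\<close> with \<open>n = CARD('k)\<close>, so these tuples form the type \<open>'h^'k\<close>.\<close>

definition tensor_power :: "'h::finite op \<Rightarrow> ('h^'k::finite) op" where
  "tensor_power A = (\<chi> i j. \<Prod>c\<in>UNIV. A $ (i $ c) $ (j $ c))"

definition block_op :: "('p::finite \<Rightarrow> 'p \<Rightarrow> 'h::finite op) \<Rightarrow> ('p \<times> 'h) op" where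
  "block_op L = (\<chi> i j. L (fst i) (fst j) $ snd i $ snd j)"

subsection \<open>Parametrised states at the point 0\<close>

definition partial_at_0 :: "(real^'p::finite \<Rightarrow> 'h::finite op) \<Rightarrow> 'p \<Rightarrow> 'h op" where
  "partial_at_0 F \<mu> = vector_derivative (\<lambda>t. F (axis \<mu> t)) (at 0)"

definition copies_state :: "(real^'p::finite \<Rightarrow> 'h::finite op) \<Rightarrow> ('h^'k::finite) op" where
  "copies_state \<rho> = tensor_power (\<rho> 0)"

definition copies_deriv :: "(real^'p::finite \<Rightarrow> 'h::finite op) \<Rightarrow> 'p \<Rightarrow> ('h^'k::finite) op" where
  "copies_deriv \<rho> = partial_at_0 (\<lambda>\<theta>. tensor_power (\<rho> \<theta>))"

text \<open>Below, \<open>R\<close> is a state, and \<open>D \<mu>\<close> is its derivative in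
  direction \<open>\<mu>\<close>. Infima are taken in the extended reals, so that the infimum of an empty set
  is \<open>\<infinity>\<close>.\<close>

definition unbiased_tuple ::
    "'h::finite op \<Rightarrow> ('p::finite \<Rightarrow> 'h op) \<Rightarrow> ('p \<Rightarrow> 'h op) \<Rightarrow> bool" where
  "unbiased_tuple R D X \<longleftrightarrow>
     (\<forall>\<mu>. hermitian (X \<mu>)) \<and>
     (\<forall>\<mu>. trace (R ** X \<mu>) = 0) \<and>
     (\<forall>\<mu> \<nu>. trace (D \<nu> ** X \<mu>) = (if \<mu> = \<nu> then 1 else 0))"

subsection \<open>Finite-copy optimum\<close>

definition povm :: "nat \<Rightarrow> (nat \<Rightarrow> 'h::finite op) \<Rightarrow> bool" where
  "povm m M \<longleftrightarrow> (\<forall>k<m. psd (M k)) \<and> (\<Sum>k<m. M k) = mat 1"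

definition locally_unbiased ::
    "'h::finite op \<Rightarrow> ('p::finite \<Rightarrow> 'h op) \<Rightarrow> nat \<Rightarrow> (nat \<Rightarrow> 'h op) \<Rightarrow> (nat \<Rightarrow> real^'p) \<Rightarrow> bool" where
  "locally_unbiased R D m M est \<longleftrightarrow>
     (\<forall>\<mu>. (\<Sum>k<m. trace (R ** M k) * complex_of_real (est k $ \<mu>)) = 0) \<and>
     (\<forall>\<mu> \<nu>. (\<Sum>k<m. trace (D \<nu> ** M k) * complex_of_real (est k $ \<mu>)) = (if \<mu> = \<nu> then 1 else 0))"

definition mse_matrix ::
    "'h::finite op \<Rightarrow> nat \<Rightarrow> (nat \<Rightarrow> 'h op) \<Rightarrow> (nat \<Rightarrow> real^'p::finite) \<Rightarrow> real^'p^'p" where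
  "mse_matrix R m M est =
     (\<chi> \<mu> \<nu>. \<Sum>k<m. Re (trace (R ** M k)) * (est k $ \<mu>) * (est k $ \<nu>))"

definition estimation_optimum ::
    "'h::finite op \<Rightarrow> ('p::finite \<Rightarrow> 'h op) \<Rightarrow> real^'p^'p \<Rightarrow> ereal" where
  "estimation_optimum R D W =
     Inf {ereal (trace (W ** mse_matrix R m M est)) | m M est. povm m M \<and> locally_unbiased R D m M est}"

definition finite_copy_optimum ::
    "'k::finite itself \<Rightarrow> (real^'p::finite \<Rightarrow> 'h::finite op) \<Rightarrow> real^'p^'p \<Rightarrow> ereal" where
  "finite_copy_optimum copies \<rho> W =
     ereal (real CARD('k)) *
     estimation_optimum (copies_state \<rho> :: ('h^'k) op) (copies_deriv \<rho>) W"

subsection \<open>Nagaoka--Hayashi bound\<close>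

definition nh_feasible ::
    "'h::finite op \<Rightarrow> ('p::finite \<Rightarrow> 'h op) \<Rightarrow> ('p \<Rightarrow> 'h op) \<Rightarrow> ('p \<Rightarrow> 'p \<Rightarrow> 'h op) \<Rightarrow> bool" where
  "nh_feasible R D X L \<longleftrightarrow>
     unbiased_tuple R D X \<and>
     (\<forall>\<mu> \<nu>. hermitian (L \<mu> \<nu>) \<and> L \<mu> \<nu> = L \<nu> \<mu>) \<and>
     psd (block_op L - block_op (\<lambda>\<mu> \<nu>. X \<mu> ** X \<nu>))"

definition nh_optimum ::
    "'h::finite op \<Rightarrow> ('p::finite \<Rightarrow> 'h op) \<Rightarrow> real^'p^'p \<Rightarrow> ereal" where
  "nh_optimum R D W =
     Inf {ereal (\<Sum>\<mu>\<in>UNIV. \<Sum>\<nu>\<in>UNIV. W $ \<mu> $ \<nu> * Re (trace (R ** L \<mu> \<nu>))) | X L. nh_feasible R D X L}"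

definition nagaoka_hayashi_bound ::
    "'k::finite itself \<Rightarrow> (real^'p::finite \<Rightarrow> 'h::finite op) \<Rightarrow> real^'p^'p \<Rightarrow> ereal" where
  "nagaoka_hayashi_bound copies \<rho> W =
     ereal (real CARD('k)) *
     nh_optimum (copies_state \<rho> :: ('h^'k) op) (copies_deriv \<rho>) W"

subsection \<open>Holevo bound\<close>

definition holevo_Z :: "'h::finite op \<Rightarrow> ('p::finite \<Rightarrow> 'h op) \<Rightarrow> 'p op" where
  "holevo_Z R X = (\<chi> \<mu> \<nu>. trace (R ** X \<mu> ** X \<nu>))"

definition holevo_objective ::
    "'h::finite op \<Rightarrow> real^'p::finite^'p \<Rightarrow> ('p \<Rightarrow> 'h op) \<Rightarrow> real" where
  "holevo_objective R W X =
     trace (W ** map_matrix Re (holevo_Z R X)) +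
     (let S = op_sqrt (map_matrix complex_of_real W)
      in trace_norm (S ** map_matrix complex_of_real (map_matrix Im (holevo_Z R X)) ** S))"

text \<open>Unlike the two quantities above, this is a minimum, hence \<open>LEAST\<close> instead of \<open>Inf\<close>.\<close>

definition holevo_bound ::
    "(real^'p::finite \<Rightarrow> 'h::finite op) \<Rightarrow> real^'p^'p \<Rightarrow> ereal" where
  "holevo_bound \<rho> W =
     (LEAST c. \<exists>X. unbiased_tuple (\<rho> 0) (partial_at_0 \<rho>) X \<and> c = ereal (holevo_objective (\<rho> 0) W X))"

subsection \<open>The two-qubit model\<close>

text \<open>The index type \<open>2\<close> has the elements \<open>1\<close> and \<open>2 = 0\<close>. As in \<open>vector\<close>, index \<open>1\<close> comes first,
  so \<open>1\<close> labels the basis vector ket 0 and \<open>2\<close> labels ket 1.\<close>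

definition sigma_x :: "2 op" where
  "sigma_x = vector [vector [0, 1], vector [1, 0]]"

definition sigma_y :: "2 op" where
  "sigma_y = vector [vector [0, - \<i>], vector [\<i>, 0]]"

definition ket0_bra0 :: "2 op" where
  "ket0_bra0 = vector [vector [1, 0], vector [0, 0]]"

definition rho0 :: "(2 \<times> 2) op" where
  "rho0 = ket0_bra0 \<otimes>\<^sub>o cscale (1/2) (mat 1)"

definition model_unitary :: "real^3 \<Rightarrow> (2 \<times> 2) op" where
  "model_unitary \<theta> = op_exp (cscale (- \<i> * complex_of_real (sqrt 2))
     (\<theta> $ 1 *\<^sub>R (sigma_x \<otimes>\<^sub>o mat 1) + \<theta> $ 2 *\<^sub>R (sigma_y \<otimes>\<^sub>o mat 1) + \<theta> $ 3 *\<^sub>R (sigma_y \<otimes>\<^sub>o sigma_x)))"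

definition model_state :: "real^3 \<Rightarrow> (2 \<times> 2) op" where
  "model_state \<theta> = model_unitary \<theta> ** rho0 ** dagger (model_unitary \<theta>)"

end

theory Submission
  imports Defs
begin

text \<open>All operators of the model commute with \<open>\<sigma>\<^sub>x\<close> on \<open>t\<close>. In its eigenbasis, with eigenvalues \<open>t = \<plusminus>1\<close>, a copy
  is, to first order, the pure qubit \<open>|0\<rangle> + \<surd>2 (\<theta>\<^sub>2 + t \<theta>\<^sub>3 - i \<theta>\<^sub>1) |1\<rangle>\<close> with a known, uniformly random sign \<open>t\<close>.

  One copy: measure the \<open>\<theta>\<^sub>1\<close>-quadrature with probability \<open>\<surd>2 - 1\<close> and the \<open>\<theta>\<^sub>2 + t \<theta>\<^sub>3\<close>-quadrature otherwise.
  Two copies: if the signs agree, measure the quadrature of \<open>\<theta>\<^sub>2 + t \<theta>\<^sub>3\<close>. If they differ, then \<open>\<theta>\<^sub>1\<close> and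
  \<open>\<theta>\<^sub>3\<close> displace \<open>|00\<rangle>\<close> towards the symmetric and the antisymmetric single excitation; these two displacements
  are compatible, so both are measured, and \<open>\<theta>\<^sub>2\<close> is ignored.

  Every POVM estimator gives a feasible pair for the Nagaoka--Hayashi program by the Cauchy--Schwarz inequality, so it
  remains to bound that program from below. Testing \<open>L \<ge> (X\<^sub>\<mu> X\<^sub>\<nu>)\<close> on vectors \<open>c \<otimes> u\<close> bounds the objective by
  squared norms of combinations of the \<open>X\<^sub>\<mu> u\<close>, and unbiasedness fixes a linear functional of these vectors.
  For two copies, as for the Holevo bound, the combinations are \<open>i X\<^sub>1 + X\<^sub>2\<close> and \<open>X\<^sub>3\<close>. For one copy the
  combination \<open>X\<^sub>1 - i (X\<^sub>2 + t X\<^sub>3) / \<surd>2\<close> may depend on the sign \<open>t\<close>, which is why the bound is larger.\<close>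

subsection \<open>Positive semidefinite operators\<close>

lemma dagger_nth [simp]: "dagger A $ i $ j = cnj (A $ j $ i)"
  by (simp add: dagger_def)

lemma cscale_nth [simp]: "cscale c A $ i $ j = c * A $ i $ j"
  by (simp add: cscale_def)

lemma tensor_op_nth [simp]: "(A \<otimes>\<^sub>o B) $ i $ j = A $ fst i $ fst j * B $ snd i $ snd j"
  by (simp add: tensor_op_def)

lemma block_op_nth [simp]: "block_op L $ i $ j = L (fst i) (fst j) $ snd i $ snd j"
  by (simp add: block_op_def)

lemma hermitian_nth: "hermitian A \<longleftrightarrow> (\<forall>i j. cnj (A $ i $ j) = A $ j $ i)"
  by (auto simp: hermitian_def vec_eq_iff)

lemma hermitianD: "hermitian A \<Longrightarrow> cnj (A $ i $ j) = A $ j $ i"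
  by (simp add: hermitian_nth)

lemma dagger_mult: "dagger (A ** B) = dagger B ** dagger A"
  by (simp add: vec_eq_iff matrix_matrix_mult_def cnj_sum mult.commute)

lemma sum_UNIV_prod:
  fixes f :: "'a::finite \<times> 'b::finite \<Rightarrow> 'c::comm_monoid_add"
  shows "(\<Sum>i\<in>UNIV. f i) = (\<Sum>a\<in>UNIV. \<Sum>b\<in>UNIV. f (a, b))"
  unfolding UNIV_Times_UNIV[symmetric] by (simp add: sum.cartesian_product)

lemma inner_complex_eq: "x \<bullet> y = Re (cnj x * y)" for x y :: complex
  by (simp add: inner_complex_def)

lemma inner_vec_complex:
  fixes x y :: "complex^'h::finite"
  shows "x \<bullet> y = Re (\<Sum>i\<in>UNIV. cnj (x $ i) * y $ i)"
  by (simp add: inner_vec_def inner_complex_eq)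

lemma psd_iff_inner: "psd A \<longleftrightarrow> hermitian A \<and> (\<forall>v. 0 \<le> v \<bullet> (A *v v))"
  by (simp add: psd_def inner_vec_complex)

lemma inner_matrix_vector:
  fixes A :: "'h::finite op"
  shows "x \<bullet> (A *v y) = Re (\<Sum>i\<in>UNIV. \<Sum>j\<in>UNIV. cnj (x $ i) * A $ i $ j * y $ j)"
  by (simp add: inner_vec_complex matrix_vector_mult_def sum_distrib_left mult.assoc)

lemma dagger_adjoint: "(dagger A *v x) \<bullet> y = x \<bullet> (A *v y)"
proof -
  have "(dagger A *v x) \<bullet> y = y \<bullet> (dagger A *v x)"
    by (simp add: inner_commute)
  also have "\<dots> = Re (cnj (\<Sum>i\<in>UNIV. \<Sum>j\<in>UNIV. cnj (y $ i) * dagger A $ i $ j * x $ j))"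
    by (simp only: inner_matrix_vector complex_cnj Re_complex_of_real cnj.simps(1))
  also have "\<dots> = x \<bullet> (A *v y)"
    unfolding inner_matrix_vector
    by (subst sum.swap) (simp add: cnj_sum algebra_simps)
  finally show ?thesis .
qed

lemma hermitian_adjoint: "hermitian A \<Longrightarrow> (A *v x) \<bullet> y = x \<bullet> (A *v y)"
  using dagger_adjoint[of A x y] by (simp add: hermitian_def)

text \<open>A vector indexed by pairs is regrouped into a family of vectors, one per block, so that
  the quadratic form becomes a double sum over blocks.\<close>

lemma psd_block_op_iff:
  fixes P :: "'p::finite \<Rightarrow> 'p \<Rightarrow> 'h::finite op"
  shows "psd (block_op P) \<longleftrightarrow>
    (\<forall>\<mu> \<nu>. dagger (P \<mu> \<nu>) = P \<nu> \<mu>) \<and>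
    (\<forall>v :: 'p \<Rightarrow> complex^'h. 0 \<le> (\<Sum>\<mu>\<in>UNIV. \<Sum>\<nu>\<in>UNIV. v \<mu> \<bullet> (P \<mu> \<nu> *v v \<nu>)))"
proof -
  have herm: "hermitian (block_op P) \<longleftrightarrow> (\<forall>\<mu> \<nu>. dagger (P \<mu> \<nu>) = P \<nu> \<mu>)"
    by (auto simp: hermitian_nth vec_eq_iff)
  have form: "w \<bullet> (block_op P *v w) =
      (\<Sum>\<mu>\<in>UNIV. \<Sum>\<nu>\<in>UNIV. (\<chi> i. w $ (\<mu>, i)) \<bullet> (P \<mu> \<nu> *v (\<chi> i. w $ (\<nu>, i))))" for w
    unfolding inner_matrix_vector sum_UNIV_prod
    by (simp, rule sum.cong[OF refl], subst sum.swap) simp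
  have "(\<forall>w. 0 \<le> w \<bullet> (block_op P *v w)) \<longleftrightarrow>
    (\<forall>v :: 'p \<Rightarrow> complex^'h. 0 \<le> (\<Sum>\<mu>\<in>UNIV. \<Sum>\<nu>\<in>UNIV. v \<mu> \<bullet> (P \<mu> \<nu> *v v \<nu>)))"
    (is "?L \<longleftrightarrow> ?R")
  proof
    assume L: ?L
    show ?R
    proof
      fix v :: "'p \<Rightarrow> complex^'h"
      show "0 \<le> (\<Sum>\<mu>\<in>UNIV. \<Sum>\<nu>\<in>UNIV. v \<mu> \<bullet> (P \<mu> \<nu> *v v \<nu>))"
        using L[rule_format, of "\<chi> a. v (fst a) $ snd a"] unfolding form by (simp add: vec_nth_inverse)
    qed
  qed (simp add: form)
  with herm show ?thesis by (simp add: psd_iff_inner)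
qed

lemma matrix_vector_mult_sum_left:
  fixes A :: "'a \<Rightarrow> complex^'h^'h::finite"
  shows "(\<Sum>k\<in>K. A k) *v x = (\<Sum>k\<in>K. A k *v x)"
  by (induction K rule: infinite_finite_induct) (simp_all add: matrix_vector_mult_add_rdistrib)

lemma matrix_vector_mult_scaleR_left:
  "(r *\<^sub>R A) *v x = r *\<^sub>R (A *v x)" for A :: "complex^'h^'h::finite"
  by (simp add: vec_eq_iff matrix_vector_mult_def scaleR_sum_right)

lemma matrix_vector_mult_scaleR_right:
  "A *v (r *\<^sub>R x) = r *\<^sub>R (A *v x)" for A :: "complex^'h^'h::finite"
  by (simp add: vec_eq_iff matrix_vector_mult_def scaleR_sum_right)

lemma matrix_diff_ldistrib: "A ** (B - C) = A ** B - A ** C" for A B C :: "complex^'h^'h::finite"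
  by (simp add: vec_eq_iff matrix_matrix_mult_def right_diff_distrib sum_subtractf)

lemma matrix_diff_rdistrib: "(A - B) ** C = A ** C - B ** C" for A B C :: "complex^'h^'h::finite"
  by (simp add: vec_eq_iff matrix_matrix_mult_def left_diff_distrib sum_subtractf)

lemma matrix_vector_axis: "A *v axis k 1 = column k A" for A :: "complex^'h^'h::finite"
  by (simp add: vec_eq_iff matrix_vector_mult_def column_def axis_def if_distrib cong: if_cong)

text \<open>Otherwise moving \<open>v\<close> against \<open>B *v v\<close> changes the quadratic
  form at first order and makes it negative.\<close>

lemma psd_inner_zero:
  assumes "psd B" "v \<bullet> (B *v v) = 0"
  shows "B *v v = 0"
proof (rule ccontr)
  define w where "w = B *v v"
  define a where "a = w \<bullet> w"
  define b where "b = w \<bullet> (B *v w)"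
  assume "B *v v \<noteq> 0"
  then have a: "a > 0" by (simp add: a_def w_def)
  have b: "b \<ge> 0" using assms(1) by (simp add: b_def psd_iff_inner)
  have vBw: "v \<bullet> (B *v w) = a"
    using assms(1) hermitian_adjoint[of B v w] by (simp add: psd_iff_inner a_def w_def)
  have "(v + s *\<^sub>R w) \<bullet> (B *v (v + s *\<^sub>R w)) = 2 * s * a + s\<^sup>2 * b" for s
    using assms(2) vBw
    by (simp add: matrix_vector_right_distrib inner_add_left inner_add_right
          matrix_vector_mult_scaleR_right power2_eq_square algebra_simps a_def b_def flip: w_def)
  then have ge: "0 \<le> 2 * s * a + s\<^sup>2 * b" for s
    using assms(1) by (metis psd_iff_inner)
  \<comment> \<open>At \<open>s = - c\<close> the form is \<open>c * (c * b - 2 * a)\<close>,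
    negative once \<open>c * b < 2 * a\<close>; the \<open>+ 1\<close> avoids a division by zero
    when \<open>b = 0\<close>.\<close>
  define c where "c = a / (b + 1)"
  have c: "c > 0" "c * b = a - c" using a b by (simp_all add: c_def field_simps)
  have "0 \<le> c * (c * b - 2 * a)"
    using ge[of "- c"] by (simp add: power2_eq_square algebra_simps)
  with c a show False by (simp add: zero_le_mult_iff)
qed

text \<open>Needed to evaluate the definite description in \<open>op_sqrt\<close>. For
  \<open>D = B - C\<close>, equality of the squares gives \<open>B ** D + D ** C = 0\<close>.
  Multiplying by \<open>D\<close> and taking the trace leaves two nonnegative terms with sum zero,
  so \<open>B\<close> and \<open>C\<close> annihilate the columns of \<open>D\<close>, whence
  \<open>D ** D = 0\<close>.\<close>

lemma psd_sqrt_unique: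
  fixes B C :: "'h::finite op"
  assumes "psd B" "psd C" and eq: "B ** B = C ** C"
  shows "B = C"
proof -
  define D where "D = B - C"
  have hD: "hermitian D"
    using assms(1,2) by (simp add: psd_iff_inner hermitian_nth D_def)
  have tr: "Re (trace (D ** (A ** D))) = (\<Sum>k\<in>UNIV. column k D \<bullet> (A *v column k D))" for A
    unfolding trace_def matrix_matrix_mult_def inner_matrix_vector column_def
    using hD by (simp add: hermitianD sum_distrib_left mult.assoc)
  have "B ** D + D ** C = 0"
    using eq by (simp add: D_def matrix_diff_ldistrib matrix_diff_rdistrib)
  then have "D ** (B ** D) + D ** (D ** C) = 0"
    by (metis matrix_add_ldistrib times0_right)
  moreover have "trace (D ** (D ** C)) = trace (D ** (C ** D))"
    by (metis trace_mul_sym matrix_mul_assoc)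
  ultimately have "trace (D ** (B ** D)) + trace (D ** (C ** D)) = 0"
    by (metis trace_add trace_0 mat_0)
  then have sum0: "(\<Sum>k\<in>UNIV. column k D \<bullet> (B *v column k D)) + (\<Sum>k\<in>UNIV. column k D \<bullet> (C *v column k D)) = 0"
    by (metis tr plus_complex.sel(1) zero_complex.sel(1))
  have nonneg: "0 \<le> v \<bullet> (B *v v)" "0 \<le> v \<bullet> (C *v v)" for v
    using assms(1,2) by (auto simp: psd_iff_inner)
  have "(\<Sum>k\<in>UNIV. column k D \<bullet> (B *v column k D)) = 0" "(\<Sum>k\<in>UNIV. column k D \<bullet> (C *v column k D)) = 0"
    using sum0 by (simp_all add: add_nonneg_eq_0_iff nonneg sum_nonneg)
  then have "column k D \<bullet> (B *v column k D) = 0" "column k D \<bullet> (C *v column k D) = 0" for k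
    by (simp_all add: sum_nonneg_eq_0_iff nonneg)
  then have "B *v column k D = 0" "C *v column k D = 0" for k
    using psd_inner_zero assms(1,2) by blast+
  then have "D *v column k D = 0" for k
    by (simp add: D_def matrix_vector_mult_diff_rdistrib)
  then have "column k D \<bullet> column k D = 0" for k
    using hD hermitian_adjoint[OF hD, of "axis k 1" "column k D"]
    by (simp add: matrix_vector_axis)
  then have "D = 0"
    by (simp add: vec_eq_iff column_def)
  then show ?thesis by (simp add: D_def)
qed

lemma op_sqrt_eqI: "psd B \<Longrightarrow> B ** B = A \<Longrightarrow> op_sqrt A = B"
  unfolding op_sqrt_def by (rule the_equality) (auto intro: psd_sqrt_unique)

subsection \<open>Nagaoka--Hayashi bound and estimators\<close>

lemma inner_mult_hermitian: "hermitian A \<Longrightarrow> u \<bullet> ((A ** B) *v w) = (A *v u) \<bullet> (B *v w)"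
  by (metis hermitian_adjoint matrix_vector_mul_assoc)

lemma inner_sum_sum: "(\<Sum>i\<in>I. f i) \<bullet> (\<Sum>j\<in>J. g j) = (\<Sum>i\<in>I. \<Sum>j\<in>J. f i \<bullet> g j)"
  unfolding inner_sum_left unfolding inner_sum_right ..

text \<open>The semidefinite constraint is evaluated on the tuple \<open>v\<close>. As every
  \<open>X \<mu>\<close> is Hermitian, the part with \<open>X \<mu> ** X \<nu>\<close> is a Gram sum
  and collapses to a squared norm.\<close>

lemma nh_feasible_norm_le:
  assumes "nh_feasible R D X L"
  shows "(norm (\<Sum>\<mu>\<in>UNIV. X \<mu> *v v \<mu>))\<^sup>2 \<le> (\<Sum>\<mu>\<in>UNIV. \<Sum>\<nu>\<in>UNIV. v \<mu> \<bullet> (L \<mu> \<nu> *v v \<nu>))"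
proof -
  have herm: "hermitian (X \<mu>)" for \<mu>
    using assms by (simp add: nh_feasible_def unbiased_tuple_def)
  have "block_op L - block_op (\<lambda>\<mu> \<nu>. X \<mu> ** X \<nu>) = block_op (\<lambda>\<mu> \<nu>. L \<mu> \<nu> - X \<mu> ** X \<nu>)"
    by (simp add: vec_eq_iff)
  then have "psd (block_op (\<lambda>\<mu> \<nu>. L \<mu> \<nu> - X \<mu> ** X \<nu>))"
    using assms by (simp add: nh_feasible_def)
  then have "0 \<le> (\<Sum>\<mu>\<in>UNIV. \<Sum>\<nu>\<in>UNIV. v \<mu> \<bullet> ((L \<mu> \<nu> - X \<mu> ** X \<nu>) *v v \<nu>))"
    by (simp add: psd_block_op_iff)
  also have "\<dots> = (\<Sum>\<mu>\<in>UNIV. \<Sum>\<nu>\<in>UNIV. v \<mu> \<bullet> (L \<mu> \<nu> *v v \<nu>)) -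
      (\<Sum>\<mu>\<in>UNIV. \<Sum>\<nu>\<in>UNIV. (X \<mu> *v v \<mu>) \<bullet> (X \<nu> *v v \<nu>))"
    by (simp add: matrix_vector_mult_diff_rdistrib inner_diff_right sum_subtractf inner_mult_hermitian herm)
  also have "(\<Sum>\<mu>\<in>UNIV. \<Sum>\<nu>\<in>UNIV. (X \<mu> *v v \<mu>) \<bullet> (X \<nu> *v v \<nu>)) = (norm (\<Sum>\<mu>\<in>UNIV. X \<mu> *v v \<mu>))\<^sup>2"
    by (simp add: power2_norm_eq_inner inner_sum_sum)
  finally show ?thesis by simp
qed

text \<open>The complex form \<open>q\<close> is real for Hermitian \<open>A\<close>, so only the
  real part of \<open>cnj a * b\<close> survives.\<close>

lemma inner_scaled_hermitian:
  assumes "hermitian A"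
  shows "(a *s u) \<bullet> (A *v (b *s u)) = Re (cnj a * b) * (u \<bullet> (A *v u))"
proof -
  define q where "q = (\<Sum>i\<in>UNIV. \<Sum>j\<in>UNIV. cnj (u $ i) * A $ i $ j * u $ j)"
  have "cnj q = q"
    unfolding q_def using assms
    by (subst sum.swap) (simp add: cnj_sum hermitianD mult.commute mult.left_commute)
  then have q: "Im q = 0" by (simp add: complex_eq_iff)
  have "(\<Sum>i\<in>UNIV. \<Sum>j\<in>UNIV. cnj ((a *s u) $ i) * A $ i $ j * (b *s u) $ j) = cnj a * b * q"
    by (simp add: q_def sum_distrib_left mult_ac)
  with q show ?thesis
    by (simp add: inner_matrix_vector flip: q_def)
qed

text \<open>The case of product vectors. Imaginary products \<open>cnj (c \<mu>) * c \<nu>\<close>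
  disappear from the right-hand side; the lower bounds exploit this by choosing complex
  \<open>c\<close>.\<close>

lemma nh_feasible_scaled_norm_le:
  assumes "nh_feasible R D X L"
  shows "(norm (\<Sum>\<mu>\<in>UNIV. c \<mu> *s (X \<mu> *v u)))\<^sup>2 \<le>
    (\<Sum>\<mu>\<in>UNIV. \<Sum>\<nu>\<in>UNIV. Re (cnj (c \<mu>) * c \<nu>) * (u \<bullet> (L \<mu> \<nu> *v u)))"
proof -
  have "hermitian (L \<mu> \<nu>)" for \<mu> \<nu>
    using assms by (simp add: nh_feasible_def)
  moreover have "X \<mu> *v (c \<mu> *s u) = c \<mu> *s (X \<mu> *v u)" for \<mu>
    by (simp add: vector_scalar_commute)
  ultimately show ?thesis
    using nh_feasible_norm_le[OF assms, of "\<lambda>\<mu>. c \<mu> *s u"] by (simp add: inner_scaled_hermitian)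
qed

lemma matrix_mult_sum_right:
  fixes A :: "complex^'h^'h::finite"
  shows "A ** (\<Sum>k\<in>K. B k) = (\<Sum>k\<in>K. A ** B k)"
  by (induction K rule: infinite_finite_induct) (simp_all add: matrix_add_ldistrib)

lemma trace_sum: "trace (\<Sum>k\<in>K. A k) = (\<Sum>k\<in>K. trace (A k))"
  for A :: "'a \<Rightarrow> complex^'h^'h::finite"
  by (induction K rule: infinite_finite_induct) (simp_all add: trace_add trace_0 flip: mat_0)

lemma trace_mult_scaleR: "trace (A ** (r *\<^sub>R B)) = trace (A ** B) * complex_of_real r"
  for A B :: "complex^'h^'h::finite"
  by (simp add: trace_def matrix_matrix_mult_def sum_distrib_left scaleR_conv_of_real[where 'a = complex] mult_ac)

lemma trace_mult_weighted_sum: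
  fixes A :: "complex^'h^'h::finite"
  shows "trace (A ** (\<Sum>k\<in>K. w k *\<^sub>R M k)) = (\<Sum>k\<in>K. trace (A ** M k) * complex_of_real (w k))"
  by (simp add: matrix_mult_sum_right trace_sum trace_mult_scaleR)

lemma dagger_weighted_sum: "dagger (\<Sum>k\<in>K. (w k :: real) *\<^sub>R M k) = (\<Sum>k\<in>K. w k *\<^sub>R dagger (M k))"
  by (simp add: vec_eq_iff cnj_sum)

text \<open>Expand the nonnegative sum of \<open>(w k - u) \<bullet> (M k *v (w k - u))\<close>;
  completeness of the POVM makes the last term sum to \<open>u \<bullet> u\<close>.\<close>

lemma povm_cauchy_schwarz:
  fixes w :: "nat \<Rightarrow> complex^'h::finite"
  assumes "povm m M"
  defines "u \<equiv> \<Sum>k<m. M k *v w k"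
  shows "u \<bullet> u \<le> (\<Sum>k<m. w k \<bullet> (M k *v w k))"
proof -
  have psd: "psd (M k)" if "k < m" for k
    using assms(1) that by (simp add: povm_def)
  have one: "(\<Sum>k<m. M k *v u) = u"
    using assms(1) by (simp add: povm_def flip: matrix_vector_mult_sum_left)
  have "0 \<le> (\<Sum>k<m. (w k - u) \<bullet> (M k *v (w k - u)))"
    using psd by (intro sum_nonneg) (simp add: psd_iff_inner)
  also have "\<dots> = (\<Sum>k<m. w k \<bullet> (M k *v w k) - u \<bullet> (M k *v w k) - u \<bullet> (M k *v w k) + u \<bullet> (M k *v u))"
  proof (intro sum.cong refl)
    fix k assume "k \<in> {..<m}"
    then have "w k \<bullet> (M k *v u) = u \<bullet> (M k *v w k)"
      using psd[of k] hermitian_adjoint[of "M k" "w k" u] by (simp add: psd_iff_inner inner_commute)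
    then show "(w k - u) \<bullet> (M k *v (w k - u)) =
        w k \<bullet> (M k *v w k) - u \<bullet> (M k *v w k) - u \<bullet> (M k *v w k) + u \<bullet> (M k *v u)"
      by (simp add: matrix_vector_mult_diff_distrib inner_diff_left inner_diff_right)
  qed
  also have "\<dots> = (\<Sum>k<m. w k \<bullet> (M k *v w k)) - u \<bullet> u - u \<bullet> u + u \<bullet> u"
    by (simp only: sum.distrib sum_subtractf one inner_sum_right[symmetric] u_def[symmetric])
  finally show ?thesis by simp
qed

text \<open>Positivity is \<open>povm_cauchy_schwarz\<close> applied to the combinations
  \<open>w k\<close> of the \<open>v \<mu>\<close> with the estimates as coefficients.\<close>

lemma nh_feasible_of_povm:
  assumes povm: "povm m M" and unb: "locally_unbiased R D m M est"
  shows "nh_feasible R D (\<lambda>\<mu>. \<Sum>k<m. est k $ \<mu> *\<^sub>R M k)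
    (\<lambda>\<mu> \<nu>. \<Sum>k<m. (est k $ \<mu> * est k $ \<nu>) *\<^sub>R M k)"
proof -
  define X where "X = (\<lambda>\<mu>. \<Sum>k<m. est k $ \<mu> *\<^sub>R M k)"
  define L where "L = (\<lambda>\<mu> \<nu>. \<Sum>k<m. (est k $ \<mu> * est k $ \<nu>) *\<^sub>R M k)"
  have dag: "dagger (M k) = M k" if "k < m" for k
    using povm that by (simp add: povm_def psd_def hermitian_def)
  have hX: "hermitian (X \<mu>)" and hL: "hermitian (L \<mu> \<nu>)" for \<mu> \<nu>
    by (simp_all add: hermitian_def X_def L_def dagger_weighted_sum dag)
  have symL: "L \<mu> \<nu> = L \<nu> \<mu>" for \<mu> \<nu>
    by (simp add: L_def mult.commute)
  have "0 \<le> (\<Sum>\<mu>\<in>UNIV. \<Sum>\<nu>\<in>UNIV. v \<mu> \<bullet> ((L \<mu> \<nu> - X \<mu> ** X \<nu>) *v v \<nu>))" for v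
  proof -
    define w where "w = (\<lambda>k. \<Sum>\<mu>\<in>UNIV. est k $ \<mu> *\<^sub>R v \<mu>)"
    have Mw: "M k *v w k = (\<Sum>\<mu>\<in>UNIV. est k $ \<mu> *\<^sub>R (M k *v v \<mu>))" for k
      unfolding w_def
      by (subst linear_sum[OF matrix_vector_mul_linear]) (simp add: matrix_vector_mult_scaleR_right)
    have "(\<Sum>k<m. M k *v w k) = (\<Sum>\<mu>\<in>UNIV. X \<mu> *v v \<mu>)"
      unfolding Mw X_def matrix_vector_mult_sum_left matrix_vector_mult_scaleR_left by (rule sum.swap)
    then have u: "(\<Sum>k<m. M k *v w k) \<bullet> (\<Sum>k<m. M k *v w k) =
        (\<Sum>\<mu>\<in>UNIV. \<Sum>\<nu>\<in>UNIV. v \<mu> \<bullet> ((X \<mu> ** X \<nu>) *v v \<nu>))"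
      by (simp add: inner_sum_sum inner_mult_hermitian hX)
    have "(\<Sum>k<m. w k \<bullet> (M k *v w k)) =
        (\<Sum>k<m. \<Sum>\<mu>\<in>UNIV. \<Sum>\<nu>\<in>UNIV. v \<mu> \<bullet> (((est k $ \<mu> * est k $ \<nu>) *\<^sub>R M k) *v v \<nu>))"
      unfolding Mw
      by (simp add: w_def inner_sum_sum matrix_vector_mult_scaleR_left mult_ac)
    also have "\<dots> = (\<Sum>\<mu>\<in>UNIV. \<Sum>k<m. \<Sum>\<nu>\<in>UNIV. v \<mu> \<bullet> (((est k $ \<mu> * est k $ \<nu>) *\<^sub>R M k) *v v \<nu>))"
      by (rule sum.swap)
    also have "\<dots> = (\<Sum>\<mu>\<in>UNIV. \<Sum>\<nu>\<in>UNIV. v \<mu> \<bullet> (L \<mu> \<nu> *v v \<nu>))"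
      unfolding L_def matrix_vector_mult_sum_left inner_sum_right
      by (intro sum.cong refl sum.swap)
    finally show ?thesis
      using povm_cauchy_schwarz[OF povm, of w] unfolding u
      by (simp add: matrix_vector_mult_diff_rdistrib inner_diff_right sum_subtractf)
  qed
  moreover have "dagger (L \<mu> \<nu> - X \<mu> ** X \<nu>) = L \<nu> \<mu> - X \<nu> ** X \<mu>" for \<mu> \<nu>
  proof -
    have "dagger (L \<mu> \<nu> - X \<mu> ** X \<nu>) = dagger (L \<mu> \<nu>) - dagger (X \<mu> ** X \<nu>)"
      by (simp add: vec_eq_iff)
    then show ?thesis using hX hL symL[of \<mu> \<nu>] by (simp add: dagger_mult hermitian_def)
  qed
  moreover have "block_op L - block_op (\<lambda>\<mu> \<nu>. X \<mu> ** X \<nu>) = block_op (\<lambda>\<mu> \<nu>. L \<mu> \<nu> - X \<mu> ** X \<nu>)"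
    by (simp add: vec_eq_iff)
  ultimately have psd: "psd (block_op L - block_op (\<lambda>\<mu> \<nu>. X \<mu> ** X \<nu>))"
    by (simp add: psd_block_op_iff)
  have "unbiased_tuple R D X"
    using unb hX by (simp add: unbiased_tuple_def locally_unbiased_def X_def trace_mult_weighted_sum)
  with psd hL symL show ?thesis
    unfolding nh_feasible_def X_def[symmetric] L_def[symmetric] by blast
qed

text \<open>The pair built from an estimator has the weighted mean-square error as its objective
  value.\<close>

lemma nh_optimum_le_estimation_optimum: "nh_optimum R D W \<le> estimation_optimum R D W"
proof -
  have "nh_optimum R D W \<le> ereal (trace (W ** mse_matrix R m M est))"
    if "povm m M" "locally_unbiased R D m M est" for m M est
  proof -
    have "trace (W ** mse_matrix R m M est) = (\<Sum>\<mu>\<in>UNIV. \<Sum>\<nu>\<in>UNIV. W $ \<mu> $ \<nu> *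
        Re (trace (R ** (\<Sum>k<m. (est k $ \<mu> * est k $ \<nu>) *\<^sub>R M k))))"
      unfolding trace_def[where 'a = real] matrix_matrix_mult_def[of W] mse_matrix_def trace_mult_weighted_sum
      by (simp add: mult_ac)
    then show ?thesis
      unfolding nh_optimum_def using nh_feasible_of_povm[OF that] by (intro Inf_lower) auto
  qed
  then show ?thesis
    unfolding estimation_optimum_def by (auto intro!: Inf_greatest)
qed

section \<open>Measurements with rank-one effects\<close>

definition outer :: "complex^'h \<Rightarrow> 'h::finite op" where
  "outer f = (\<chi> i j. f $ i * cnj (f $ j))"

lemma outer_nth [simp]: "outer f $ i $ j = f $ i * cnj (f $ j)"
  by (simp add: outer_def)

lemma psd_outer: "psd (outer f)"
proof -
  have "v \<bullet> (outer f *v v) = (cmod (\<Sum>i\<in>UNIV. cnj (v $ i) * f $ i))\<^sup>2" for v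
  proof -
    have "complex_of_real ((cmod (\<Sum>i\<in>UNIV. cnj (v $ i) * f $ i))\<^sup>2) =
        (\<Sum>i\<in>UNIV. cnj (v $ i) * f $ i) * cnj (\<Sum>i\<in>UNIV. cnj (v $ i) * f $ i)"
      by (simp only: complex_norm_square)
    also have "\<dots> = (\<Sum>i\<in>UNIV. \<Sum>j\<in>UNIV. cnj (v $ i) * outer f $ i $ j * v $ j)"
      by (simp add: cnj_sum sum_product mult.commute mult.left_commute)
    finally show ?thesis unfolding inner_matrix_vector by (metis Re_complex_of_real)
  qed
  then show ?thesis by (simp add: psd_iff_inner hermitian_nth)
qed

lemma psd_scaleR: "0 \<le> r \<Longrightarrow> psd A \<Longrightarrow> psd (r *\<^sub>R A)"
  by (simp add: psd_iff_inner hermitian_nth matrix_vector_mult_scaleR_left)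

text \<open>Lets the outcomes be labelled by any finite set, such as signs paired with numbers,
  instead of an initial segment of the naturals.\<close>

lemma estimation_optimum_le:
  fixes M :: "'a \<Rightarrow> 'h::finite op" and est :: "'a \<Rightarrow> real^'p::finite"
  assumes fin: "finite K"
    and psd: "\<And>k. k \<in> K \<Longrightarrow> psd (M k)"
    and one: "(\<Sum>k\<in>K. M k) = mat 1"
    and zero: "\<And>\<mu>. (\<Sum>k\<in>K. trace (R ** M k) * complex_of_real (est k $ \<mu>)) = 0"
    and delta: "\<And>\<mu> \<nu>. (\<Sum>k\<in>K. trace (D \<nu> ** M k) * complex_of_real (est k $ \<mu>)) = (if \<mu> = \<nu> then 1 else 0)"
  shows "estimation_optimum R D (mat 1) \<le> ereal (\<Sum>k\<in>K. Re (trace (R ** M k)) * (\<Sum>\<mu>\<in>UNIV. (est k $ \<mu>)\<^sup>2))"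
proof -
  obtain h where h: "bij_betw h {..<card K} K"
    using ex_bij_betw_nat_finite[OF fin] by (auto simp: lessThan_atLeast0)
  note reindex = sum.reindex_bij_betw[OF h]
  have "povm (card K) (\<lambda>k. M (h k))"
    using psd one bij_betwE[OF h] by (simp add: povm_def reindex)
  moreover have "locally_unbiased R D (card K) (\<lambda>k. M (h k)) (\<lambda>k. est (h k))"
    using zero delta
    by (simp add: locally_unbiased_def reindex[where g = "\<lambda>k. trace (R ** M k) * complex_of_real (est k $ _)"]
        reindex[where g = "\<lambda>k. trace (D _ ** M k) * complex_of_real (est k $ _)"])
  moreover have "trace (mat 1 ** mse_matrix R (card K) (\<lambda>k. M (h k)) (\<lambda>k. est (h k))) =
      (\<Sum>k\<in>K. Re (trace (R ** M k)) * (\<Sum>\<mu>\<in>UNIV. (est k $ \<mu>)\<^sup>2))"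
  proof -
    have "trace (mat 1 ** mse_matrix R (card K) (\<lambda>k. M (h k)) (\<lambda>k. est (h k))) =
        (\<Sum>\<mu>\<in>UNIV. \<Sum>k\<in>K. Re (trace (R ** M k)) * est k $ \<mu> * est k $ \<mu>)"
      unfolding matrix_mul_lid trace_def[where 'a = real] mse_matrix_def
      by (simp add: reindex[where g = "\<lambda>k. Re (trace (R ** M k)) * est k $ _ * est k $ _"])
    then show ?thesis
      by (subst (asm) sum.swap) (simp add: sum_distrib_left power2_eq_square mult.assoc)
  qed
  ultimately show ?thesis
    unfolding estimation_optimum_def
    by (intro Inf_lower CollectI exI[of _ "card K"] exI[of _ "\<lambda>k. M (h k)"] exI[of _ "\<lambda>k. est (h k)"]) simp
qed

subsection \<open>Derivatives of the model\<close>

lemma cscale_mult_left: "cscale a A ** B = cscale a (A ** B)"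
  by (simp add: vec_eq_iff matrix_matrix_mult_def sum_distrib_left mult.assoc)

lemma cscale_mult_right: "A ** cscale a B = cscale a (A ** B)"
  by (simp add: vec_eq_iff matrix_matrix_mult_def sum_distrib_left mult.left_commute)

lemma cscale_cscale: "cscale a (cscale b A) = cscale (a * b) A"
  by (simp add: vec_eq_iff mult.assoc)

lemma matrix_add_rdistrib: "(A + B) ** C = A ** C + B ** C" for A B C :: "complex^'h^'h::finite"
  by (simp add: vec_eq_iff matrix_matrix_mult_def distrib_right sum.distrib)

lemma bounded_linear_cscale: "bounded_linear (\<lambda>c. cscale c A)"
  by (intro linear_conv_bounded_linear[THEN iffD1] linearI) (simp_all add: vec_eq_iff algebra_simps)

text \<open>Even powers of \<open>G\<close> are the identity and odd ones are \<open>G\<close>. The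
  combinations of \<open>z ^ k\<close> and \<open>(- z) ^ k\<close> select the parity without a case
  split, and their exponential series are cosh and sinh.\<close>

lemma op_power_involution:
  assumes "G ** G = mat 1"
  shows "op_power (cscale z G) k = cscale ((z ^ k + (- z) ^ k) / 2) (mat 1) + cscale ((z ^ k - (- z) ^ k) / 2) G"
proof (induction k)
  case 0
  then show ?case by (simp add: op_power_def vec_eq_iff)
next
  case (Suc k)
  have "op_power (cscale z G) (Suc k) = cscale z G ** op_power (cscale z G) k"
    by (simp add: op_power_def)
  also have "\<dots> = cscale (z * ((z ^ k + (- z) ^ k) / 2)) G + cscale (z * ((z ^ k - (- z) ^ k) / 2)) (mat 1)"
    by (simp only: Suc.IH matrix_add_ldistrib cscale_mult_left cscale_mult_right matrix_mul_rid assms cscale_cscale mult.commute[of z])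
  also have "\<dots> = cscale ((z ^ Suc k + (- z) ^ Suc k) / 2) (mat 1) + cscale ((z ^ Suc k - (- z) ^ Suc k) / 2) G"
    by (simp add: vec_eq_iff algebra_simps)
  finally show ?case .
qed

lemma op_exp_involution:
  assumes "G ** G = mat 1"
  shows "op_exp (cscale (- (\<i> * complex_of_real s)) G) =
    cscale (complex_of_real (cos s)) (mat 1) + cscale (- \<i> * complex_of_real (sin s)) G"
proof -
  define z where "z = - (\<i> * complex_of_real s)"
  have exp_sums: "(\<lambda>k. z ^ k /\<^sub>R fact k) sums exp z" "(\<lambda>k. (- z) ^ k /\<^sub>R fact k) sums exp (- z)"
    by (rule exp_converges)+
  note lin = bounded_linear.sums[OF bounded_linear_cscale]
  have "(\<lambda>k. cscale ((z ^ k /\<^sub>R fact k + (- z) ^ k /\<^sub>R fact k) / 2) (mat 1) +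
          cscale ((z ^ k /\<^sub>R fact k - (- z) ^ k /\<^sub>R fact k) / 2) G)
      sums (cscale ((exp z + exp (- z)) / 2) (mat 1) + cscale ((exp z - exp (- z)) / 2) G)"
    by (intro sums_add lin sums_divide sums_diff exp_sums)
  also have "(\<lambda>k. cscale ((z ^ k /\<^sub>R fact k + (- z) ^ k /\<^sub>R fact k) / 2) (mat 1) +
          cscale ((z ^ k /\<^sub>R fact k - (- z) ^ k /\<^sub>R fact k) / 2) G) =
      (\<lambda>k. (1 / fact k) *\<^sub>R op_power (cscale z G) k)"
    by (simp add: op_power_involution[OF assms] vec_eq_iff fun_eq_iff scaleR_conv_of_real[where 'a = complex] field_simps)
  finally have "op_exp (cscale z G) = cscale ((exp z + exp (- z)) / 2) (mat 1) + cscale ((exp z - exp (- z)) / 2) G"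
    unfolding op_exp_def by (rule sums_unique[symmetric])
  moreover have "(exp z + exp (- z)) / 2 = complex_of_real (cos s)"
    by (simp add: z_def cos_exp_eq flip: cos_of_real)
  moreover have "(exp z - exp (- z)) / 2 = - \<i> * complex_of_real (sin s)"
    by (simp add: z_def sin_exp_eq field_simps flip: sin_of_real)
  ultimately show ?thesis by (simp add: z_def)
qed

definition generator :: "3 \<Rightarrow> (2 \<times> 2) op" where
  "generator \<mu> = (if \<mu> = 1 then sigma_x \<otimes>\<^sub>o mat 1 else if \<mu> = 2 then sigma_y \<otimes>\<^sub>o mat 1 else sigma_y \<otimes>\<^sub>o sigma_x)"

text \<open>By \<open>model_deriv_commutator\<close>, this is the commutator of the generator with
  \<open>rho0\<close>, times \<open>- \<i> * sqrt 2\<close>.\<close>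

definition model_deriv :: "3 \<Rightarrow> (2 \<times> 2) op" where
  "model_deriv \<mu> = cscale (complex_of_real (sqrt 2 / 2))
     (if \<mu> = 1 then - sigma_y \<otimes>\<^sub>o mat 1 else if \<mu> = 2 then sigma_x \<otimes>\<^sub>o mat 1 else sigma_x \<otimes>\<^sub>o sigma_x)"

lemma sigma_nth [simp]:
  "sigma_x $ 1 $ 1 = 0" "sigma_x $ 1 $ 2 = 1" "sigma_x $ 2 $ 1 = 1" "sigma_x $ 2 $ 2 = 0"
  "sigma_y $ 1 $ 1 = 0" "sigma_y $ 1 $ 2 = - \<i>" "sigma_y $ 2 $ 1 = \<i>" "sigma_y $ 2 $ 2 = 0"
  "ket0_bra0 $ 1 $ 1 = 1" "ket0_bra0 $ 1 $ 2 = 0" "ket0_bra0 $ 2 $ 1 = 0" "ket0_bra0 $ 2 $ 2 = 0"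
  by (simp_all add: sigma_x_def sigma_y_def ket0_bra0_def)

lemma mat_nth: "mat c $ i $ j = (if i = j then c else 0)"
  by (simp add: mat_def)

lemma generator_involution: "generator \<mu> ** generator \<mu> = mat 1"
  by (simp add: generator_def vec_eq_iff matrix_matrix_mult_def sum_UNIV_prod sum_2 forall_2 mat_nth)

lemma hermitian_generator: "hermitian (generator \<mu>)"
  by (simp add: generator_def hermitian_nth forall_2 mat_nth)

text \<open>Partial derivatives see the model only along coordinate axes, where the exponent is a
  multiple of a single involution.\<close>

lemma model_unitary_axis:
  "model_unitary (axis \<mu> t) = cscale (complex_of_real (cos (sqrt 2 * t))) (mat 1) +
     cscale (- \<i> * complex_of_real (sin (sqrt 2 * t))) (generator \<mu>)"
proof -
  have "cscale (- \<i> * complex_of_real (sqrt 2))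
     (axis \<mu> t $ 1 *\<^sub>R (sigma_x \<otimes>\<^sub>o mat 1) + axis \<mu> t $ 2 *\<^sub>R (sigma_y \<otimes>\<^sub>o mat 1) + axis \<mu> t $ 3 *\<^sub>R (sigma_y \<otimes>\<^sub>o sigma_x))
     = cscale (- (\<i> * complex_of_real (sqrt 2 * t))) (generator \<mu>)"
    using exhaust_3[of \<mu>] by (auto simp: vec_eq_iff generator_def axis_def scaleR_conv_of_real[where 'a = complex])
  then show ?thesis
    by (simp only: model_unitary_def op_exp_involution generator_involution)
qed

lemma model_state_axis:
  "model_state (axis \<mu> t) = (cos (sqrt 2 * t))\<^sup>2 *\<^sub>R rho0 + (sin (sqrt 2 * t))\<^sup>2 *\<^sub>R (generator \<mu> ** rho0 ** generator \<mu>)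
     + (cos (sqrt 2 * t) * sin (sqrt 2 * t)) *\<^sub>R cscale (- \<i>) (generator \<mu> ** rho0 - rho0 ** generator \<mu>)"
proof -
  define c s where "c = complex_of_real (cos (sqrt 2 * t))" and "s = complex_of_real (sin (sqrt 2 * t))"
  define G where "G = generator \<mu>"
  have "dagger G = G" using hermitian_generator by (simp add: hermitian_def G_def)
  then have "dagger (model_unitary (axis \<mu> t)) = cscale c (mat 1) + cscale (\<i> * s) G"
    by (auto simp: model_unitary_axis vec_eq_iff c_def s_def mat_nth simp flip: G_def)
  then have "model_state (axis \<mu> t) =
      (cscale c (mat 1) + cscale (- \<i> * s) G) ** rho0 ** (cscale c (mat 1) + cscale (\<i> * s) G)"
    by (simp add: model_state_def model_unitary_axis c_def s_def G_def)
  also have "\<dots> = cscale (c * c) rho0 + cscale (s * s) (G ** rho0 ** G) + cscale (c * s * - \<i>) (G ** rho0 - rho0 ** G)"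
    unfolding matrix_add_rdistrib matrix_add_ldistrib cscale_mult_left cscale_mult_right matrix_mul_lid matrix_mul_rid cscale_cscale
    by (simp add: vec_eq_iff algebra_simps)
  finally show ?thesis
    by (simp add: vec_eq_iff c_def s_def G_def power2_eq_square scaleR_conv_of_real[where 'a = complex])
qed

lemma model_deriv_commutator:
  "sqrt 2 *\<^sub>R cscale (- \<i>) (generator \<mu> ** rho0 - rho0 ** generator \<mu>) = model_deriv \<mu>"
  by (simp add: generator_def model_deriv_def rho0_def vec_eq_iff matrix_matrix_mult_def sum_UNIV_prod sum_2
      forall_2 mat_nth scaleR_conv_of_real[where 'a = complex])

text \<open>At 0 the squares of cosine and sine are stationary; only their product has a nonzero
  derivative.\<close>

lemma has_vector_derivative_model_state:
  "((\<lambda>t. model_state (axis \<mu> t)) has_vector_derivative model_deriv \<mu>) (at 0)"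
proof -
  define A where "A = generator \<mu> ** rho0 ** generator \<mu>"
  define B where "B = cscale (- \<i>) (generator \<mu> ** rho0 - rho0 ** generator \<mu>)"
  have "((\<lambda>t. (cos (sqrt 2 * t))\<^sup>2 *\<^sub>R rho0 + (sin (sqrt 2 * t))\<^sup>2 *\<^sub>R A + (cos (sqrt 2 * t) * sin (sqrt 2 * t)) *\<^sub>R B)
      has_vector_derivative 0 *\<^sub>R rho0 + 0 *\<^sub>R A + sqrt 2 *\<^sub>R B) (at 0)"
    by (rule derivative_eq_intros refl | simp)+
  then show ?thesis
    by (simp add: model_state_axis model_deriv_commutator A_def B_def)
qed

lemma axis_zero: "axis \<mu> (0::real) = 0"
  by (simp add: vec_eq_iff axis_def)

lemma model_state_0: "model_state 0 = rho0"
  using model_state_axis[of 1 0] by (simp add: axis_zero)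

lemma partial_at_0_model_state: "partial_at_0 model_state = model_deriv"
  by (rule ext) (simp add: partial_at_0_def vector_derivative_at has_vector_derivative_model_state)

lemma has_vector_derivative_nth_nth:
  fixes F :: "real \<Rightarrow> complex^'m::finite^'n::finite"
  assumes "(F has_vector_derivative D) (at x)"
  shows "((\<lambda>t. F t $ i $ j) has_vector_derivative D $ i $ j) (at x)"
  by (intro bounded_linear.has_vector_derivative[OF bounded_linear_vec_nth] assms)

lemma has_vector_derivative_matrixI:
  fixes F :: "real \<Rightarrow> complex^'m::finite^'n::finite"
  assumes "\<And>i j. ((\<lambda>t. F t $ i $ j) has_vector_derivative D $ i $ j) (at x)"
  shows "(F has_vector_derivative D) (at x)"
  unfolding has_vector_derivative_def has_derivative_within
proof (intro conjI vec_tendstoI)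
  show "bounded_linear (\<lambda>x. x *\<^sub>R D)" by (rule bounded_linear_scaleR_left)
  show "((\<lambda>y. ((1 / norm (y - x)) *\<^sub>R (F y - (F x + (y - x) *\<^sub>R D))) $ i $ j) \<longlongrightarrow> 0 $ i $ j) (at x)" for i j
    using assms[of i j] by (simp add: has_vector_derivative_def has_derivative_within)
qed

lemma copies_deriv_model_state_1:
  "copies_deriv model_state \<mu> = (\<chi> (i :: (2 \<times> 2)^1) j. model_deriv \<mu> $ (i $ 1) $ (j $ 1))"
  unfolding copies_deriv_def partial_at_0_def
proof (rule vector_derivative_at, rule has_vector_derivative_matrixI)
  fix i j :: "(2 \<times> 2)^1"
  show "((\<lambda>t. (tensor_power (model_state (axis \<mu> t)) :: ((2 \<times> 2)^1) op) $ i $ j)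
      has_vector_derivative (\<chi> i j. model_deriv \<mu> $ (i $ 1) $ (j $ 1)) $ i $ j) (at 0)"
    using has_vector_derivative_nth_nth[OF has_vector_derivative_model_state]
    by (simp add: tensor_power_def)
qed

text \<open>The product rule on entries, each a product of two entries of the one-copy
  state.\<close>

lemma copies_deriv_model_state_2:
  "copies_deriv model_state \<mu> = (\<chi> (i :: (2 \<times> 2)^2) j.
     model_deriv \<mu> $ (i $ 1) $ (j $ 1) * rho0 $ (i $ 2) $ (j $ 2) +
     rho0 $ (i $ 1) $ (j $ 1) * model_deriv \<mu> $ (i $ 2) $ (j $ 2))"
  unfolding copies_deriv_def partial_at_0_def
proof (rule vector_derivative_at, rule has_vector_derivative_matrixI)
  fix i j :: "(2 \<times> 2)^2"
  note der = has_vector_derivative_nth_nth[OF has_vector_derivative_model_state]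
  have state: "model_state (axis \<mu> 0) = rho0" by (simp add: axis_zero model_state_0)
  show "((\<lambda>t. (tensor_power (model_state (axis \<mu> t)) :: ((2 \<times> 2)^2) op) $ i $ j)
      has_vector_derivative (\<chi> i j. model_deriv \<mu> $ (i $ 1) $ (j $ 1) * rho0 $ (i $ 2) $ (j $ 2) +
     rho0 $ (i $ 1) $ (j $ 1) * model_deriv \<mu> $ (i $ 2) $ (j $ 2)) $ i $ j) (at 0)"
    using has_vector_derivative_mult[OF der[of \<mu> "i $ 1" "j $ 1"] der[of \<mu> "i $ 2" "j $ 2"]]
    by (simp add: tensor_power_def UNIV_2 state add.commute)
qed

subsection \<open>Traces against states and derivatives\<close>

lemma trace_mult: "trace (A ** X) = (\<Sum>i\<in>UNIV. \<Sum>j\<in>UNIV. A $ i $ j * X $ j $ i)"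
  by (simp add: trace_def matrix_matrix_mult_def)

lemma trace_rho0: "trace (rho0 ** X) = (X $ (1, 1) $ (1, 1) + X $ (1, 2) $ (1, 2)) / 2"
  by (simp add: trace_mult rho0_def sum_UNIV_prod sum_2 mat_nth)

lemma trace_model_deriv:
  "trace (model_deriv 1 ** X) = complex_of_real (sqrt 2 / 2) * \<i> *
     (X $ (2, 1) $ (1, 1) + X $ (2, 2) $ (1, 2) - X $ (1, 1) $ (2, 1) - X $ (1, 2) $ (2, 2))"
  "trace (model_deriv 2 ** X) = complex_of_real (sqrt 2 / 2) *
     (X $ (2, 1) $ (1, 1) + X $ (2, 2) $ (1, 2) + X $ (1, 1) $ (2, 1) + X $ (1, 2) $ (2, 2))"
  "trace (model_deriv 3 ** X) = complex_of_real (sqrt 2 / 2) *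
     (X $ (2, 2) $ (1, 1) + X $ (2, 1) $ (1, 2) + X $ (1, 2) $ (2, 1) + X $ (1, 1) $ (2, 2))"
  by (simp_all add: trace_mult model_deriv_def sum_UNIV_prod sum_2 mat_nth algebra_simps)

lemma hermitian_Re_Im:
  assumes "hermitian X"
  shows "Re (X $ i $ j) = Re (X $ j $ i)" "Im (X $ i $ j) = - Im (X $ j $ i)"
  using hermitianD[OF assms, of j i] by (auto simp: complex_eq_iff)

text \<open>By hermiticity, the constraints only involve the block \<open>\<langle>1|X|0\<rangle>\<close>.\<close>

lemma unbiased_entries:
  assumes "\<And>\<mu>. hermitian (X \<mu>)" "\<And>\<mu>. trace (model_deriv \<mu> ** X \<mu>) = 1"
  shows "Im (X 1 $ (2, 1) $ (1, 1)) + Im (X 1 $ (2, 2) $ (1, 2)) = - sqrt 2 / 2"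
    "Re (X 2 $ (2, 1) $ (1, 1)) + Re (X 2 $ (2, 2) $ (1, 2)) = sqrt 2 / 2"
    "Re (X 3 $ (2, 2) $ (1, 1)) + Re (X 3 $ (2, 1) $ (1, 2)) = sqrt 2 / 2"
proof -
  note h = hermitian_Re_Im[OF assms(1), of _ "(1, a)" "(2, b)" for a b]
  have s: "r = sqrt 2 / 2" if "sqrt 2 * r = 1" for r :: real
  proof -
    have "sqrt 2 * (sqrt 2 * r) = sqrt 2" using that by simp
    then show ?thesis by (simp flip: mult.assoc)
  qed
  have "Re (trace (model_deriv 1 ** X 1)) = 1" "Re (trace (model_deriv 2 ** X 2)) = 1" "Re (trace (model_deriv 3 ** X 3)) = 1"
    using assms(2) by simp_all
  then have "sqrt 2 * - (Im (X 1 $ (2, 1) $ (1, 1)) + Im (X 1 $ (2, 2) $ (1, 2))) = 1"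
    "sqrt 2 * (Re (X 2 $ (2, 1) $ (1, 1)) + Re (X 2 $ (2, 2) $ (1, 2))) = 1"
    "sqrt 2 * (Re (X 3 $ (2, 2) $ (1, 1)) + Re (X 3 $ (2, 1) $ (1, 2))) = 1"
    unfolding trace_model_deriv by (simp_all add: h algebra_simps)
  from this[THEN s] show "Im (X 1 $ (2, 1) $ (1, 1)) + Im (X 1 $ (2, 2) $ (1, 2)) = - sqrt 2 / 2"
    "Re (X 2 $ (2, 1) $ (1, 1)) + Re (X 2 $ (2, 2) $ (1, 2)) = sqrt 2 / 2"
    "Re (X 3 $ (2, 2) $ (1, 1)) + Re (X 3 $ (2, 1) $ (1, 2)) = sqrt 2 / 2"
    by simp_all
qed

text \<open>Linearised squares turn the final Cauchy--Schwarz estimates into linear arithmetic.\<close>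

lemma cmod_power2_ge:
  "2 * c * Re z - c\<^sup>2 \<le> (cmod z)\<^sup>2" "2 * c * Im z - c\<^sup>2 \<le> (cmod z)\<^sup>2"
proof -
  have "0 \<le> (Re z - c)\<^sup>2 + (Im z)\<^sup>2" "0 \<le> (Re z)\<^sup>2 + (Im z - c)\<^sup>2" by simp_all
  then show "2 * c * Re z - c\<^sup>2 \<le> (cmod z)\<^sup>2" "2 * c * Im z - c\<^sup>2 \<le> (cmod z)\<^sup>2"
    unfolding cmod_power2 by (simp_all add: power2_eq_square algebra_simps)
qed

text \<open>In the lower bounds, the two components kept are those that the unbiasedness constraints
  see.\<close>

lemma norm_power2_ge_components:
  fixes x :: "complex^'h::finite"
  assumes "i \<noteq> j"
  shows "(cmod (x $ i))\<^sup>2 + (cmod (x $ j))\<^sup>2 \<le> (norm x)\<^sup>2"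
proof -
  have "(\<Sum>k\<in>{i, j}. (cmod (x $ k))\<^sup>2) \<le> (\<Sum>k\<in>UNIV. (cmod (x $ k))\<^sup>2)"
    by (intro sum_mono2) auto
  also have "\<dots> = (norm x)\<^sup>2"
    by (simp add: norm_vec_def L2_set_def sum_nonneg)
  finally show ?thesis using assms by simp
qed

section \<open>Indices of one and two copies, and reduction to a single copy\<close>

definition single :: "'h \<Rightarrow> 'h^1" where "single a = (\<chi> _. a)"

definition pair :: "'h \<Rightarrow> 'h \<Rightarrow> 'h^2" where "pair a b = (\<chi> c. if c = 1 then a else b)"

lemma single_nth [simp]: "single a $ c = a"
  by (simp add: single_def)

lemma single_collapse: "single (i $ 1) = i"
  by (simp add: vec_eq_iff forall_1)

lemma pair_nth [simp]: "pair a b $ 1 = a" "pair a b $ 2 = b"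
  by (simp_all add: pair_def)

lemma pair_collapse: "pair (i $ 1) (i $ 2) = i"
  by (simp add: vec_eq_iff forall_2)

lemma single_eq_iff [simp]: "single a = single b \<longleftrightarrow> a = b"
  by (simp add: vec_eq_iff)

lemma pair_eq_iff [simp]: "pair a b = pair c d \<longleftrightarrow> a = c \<and> b = d"
  by (simp add: vec_eq_iff forall_2)

lemma sum_UNIV_single:
  fixes f :: "('h::finite)^1 \<Rightarrow> 'c::comm_monoid_add"
  shows "(\<Sum>i\<in>UNIV. f i) = (\<Sum>a\<in>UNIV. f (single a))"
  by (rule sum.reindex_bij_witness[of _ single "\<lambda>i. i $ 1"]) (simp_all add: single_collapse)

lemma sum_UNIV_pair:
  fixes f :: "('h::finite)^2 \<Rightarrow> 'c::comm_monoid_add"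
  shows "(\<Sum>i\<in>UNIV. f i) = (\<Sum>a\<in>UNIV. \<Sum>b\<in>UNIV. f (pair a b))"
proof -
  have "(\<Sum>i\<in>UNIV. f i) = (\<Sum>p\<in>UNIV. f (pair (fst p) (snd p)))"
    by (rule sum.reindex_bij_witness[of _ "\<lambda>p. pair (fst p) (snd p)" "\<lambda>i. (i $ 1, i $ 2)"])
       (simp_all add: pair_collapse)
  then show ?thesis by (simp add: sum_UNIV_prod)
qed

definition reduce1 :: "('h^1) op \<Rightarrow> 'h::finite op" where
  "reduce1 X = (\<chi> a b. X $ single a $ single b)"

text \<open>Contraction of one copy with \<open>rho0\<close>, summed over the choice of that copy.\<close>

definition reduce2 :: "((2 \<times> 2)^2) op \<Rightarrow> (2 \<times> 2) op" where
  "reduce2 X = (\<chi> a b. (\<Sum>x\<in>UNIV. X $ pair a (1, x) $ pair b (1, x) + X $ pair (1, x) a $ pair (1, x) b) / 2)"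

lemma reduce1_nth [simp]: "reduce1 X $ a $ b = X $ single a $ single b"
  by (simp add: reduce1_def)

lemma reduce2_nth: "reduce2 X $ a $ b = (X $ pair a (1, 1) $ pair b (1, 1) + X $ pair (1, 1) a $ pair (1, 1) b
     + X $ pair a (1, 2) $ pair b (1, 2) + X $ pair (1, 2) a $ pair (1, 2) b) / 2"
  by (simp add: reduce2_def sum_2 add.assoc)

lemma hermitian_reduce: "hermitian Y \<Longrightarrow> hermitian (reduce1 Y)" "hermitian X \<Longrightarrow> hermitian (reduce2 X)"
  by (simp_all add: hermitian_nth reduce2_nth)

lemma trace_copies_1:
  "trace (copies_state model_state ** X) = trace (rho0 ** reduce1 X)"
  "trace (copies_deriv model_state \<mu> ** X) = trace (model_deriv \<mu> ** reduce1 X)"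
  by (simp_all add: trace_mult sum_UNIV_single copies_state_def tensor_power_def model_state_0
      copies_deriv_model_state_1 reduce2_nth)

lemma trace_copies_state_2:
  "trace (copies_state model_state ** X) = (\<Sum>x\<in>UNIV. \<Sum>y\<in>UNIV. X $ pair (1, x) (1, y) $ pair (1, x) (1, y)) / 4"
  by (simp add: trace_mult sum_UNIV_pair sum_UNIV_prod sum_2 copies_state_def tensor_power_def UNIV_2
      model_state_0 rho0_def mat_nth)

lemma sum_rho0: "(\<Sum>a\<in>UNIV. \<Sum>b\<in>UNIV. rho0 $ a $ b * f a b) = (f (1, 1) (1, 1) + f (1, 2) (1, 2)) / 2"
  by (simp add: rho0_def sum_UNIV_prod sum_2 mat_nth)

text \<open>The derivative acts on one copy and leaves \<open>rho0\<close> on the other. Contracting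
  the latter turns the two-copy constraints into one-copy constraints on \<open>reduce2 X\<close>,
  to which \<open>unbiased_entries\<close> applies.\<close>

lemma trace_copies_deriv_2:
  "trace (copies_deriv model_state \<mu> ** X) = trace (model_deriv \<mu> ** reduce2 X)"
proof -
  let ?D = "model_deriv \<mu>"
  have "trace (copies_deriv model_state \<mu> ** X) =
      (\<Sum>a\<in>UNIV. \<Sum>b\<in>UNIV. \<Sum>c\<in>UNIV. \<Sum>d\<in>UNIV. ?D $ a $ c * (rho0 $ b $ d * X $ pair c d $ pair a b)) +
      (\<Sum>a\<in>UNIV. \<Sum>b\<in>UNIV. \<Sum>c\<in>UNIV. \<Sum>d\<in>UNIV. ?D $ b $ d * (rho0 $ a $ c * X $ pair c d $ pair a b))"
    by (simp add: trace_mult sum_UNIV_pair copies_deriv_model_state_2 algebra_simps sum.distrib)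
  \<comment> \<open>The sums are reordered to make the contraction with \<open>rho0\<close>
    innermost, in the form that \<open>sum_rho0\<close> evaluates.\<close>
  also have "(\<Sum>a\<in>UNIV. \<Sum>b\<in>UNIV. \<Sum>c\<in>UNIV. \<Sum>d\<in>UNIV. ?D $ a $ c * (rho0 $ b $ d * X $ pair c d $ pair a b)) =
      (\<Sum>a\<in>UNIV. \<Sum>c\<in>UNIV. ?D $ a $ c * (\<Sum>b\<in>UNIV. \<Sum>d\<in>UNIV. rho0 $ b $ d * X $ pair c d $ pair a b))"
    unfolding sum_distrib_left by (intro sum.cong refl sum.swap)
  also have "(\<Sum>a\<in>UNIV. \<Sum>b\<in>UNIV. \<Sum>c\<in>UNIV. \<Sum>d\<in>UNIV. ?D $ b $ d * (rho0 $ a $ c * X $ pair c d $ pair a b)) =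
      (\<Sum>b\<in>UNIV. \<Sum>d\<in>UNIV. ?D $ b $ d * (\<Sum>a\<in>UNIV. \<Sum>c\<in>UNIV. rho0 $ a $ c * X $ pair c d $ pair a b))"
    unfolding sum_distrib_left
    by (rule trans[OF sum.swap], rule sum.cong[OF refl], rule trans[OF _ sum.swap]) (intro sum.cong refl sum.swap)
  finally show ?thesis
    unfolding sum_rho0 by (simp add: trace_mult reduce2_nth sum.distrib algebra_simps add_divide_distrib)
qed

subsection \<open>Lower bounds\<close>

text \<open>For a fixed sign, the test with \<open>c\<close> bounds the objective with half weight
  on the last two parameters plus a cross term; the test with \<open>d\<close> trades that cross
  term for the missing halves.\<close>

lemma nh_bound_1:
  fixes L :: "3 \<Rightarrow> 3 \<Rightarrow> ((2 \<times> 2)^1) op"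
  assumes feas: "nh_feasible (copies_state model_state) (copies_deriv model_state) X L"
  shows "(3 + 2 * sqrt 2) / 8 \<le> (\<Sum>\<mu>\<in>UNIV. Re (trace (copies_state model_state ** L \<mu> \<mu>)))"
proof -
  define Y where "Y = (\<lambda>\<mu>. reduce1 (X \<mu>))"
  \<comment> \<open>For a sign \<open>t\<close>, this is the unnormalised eigenvector of
    \<open>sigma_x\<close> with the \<open>r\<close>-qubit in ket 0. Testing on eigenvectors lets
    the coefficients below depend on the sign.\<close>
  define u :: "real \<Rightarrow> complex^((2 \<times> 2)^1)" where
    "u = (\<lambda>t. axis (single (1, 1)) 1 + t *\<^sub>R axis (single (1, 2)) 1)"
  define l where "l = (\<lambda>t \<mu> \<nu>. u t \<bullet> (L \<mu> \<nu> *v u t))"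
  define y where "y = (\<lambda>t b. Y 1 $ b $ (1, 1) + t * Y 1 $ b $ (1, 2)
    - \<i> * (sqrt 2 / 2) * (Y 2 $ b $ (1, 1) + t * Y 2 $ b $ (1, 2) + t * (Y 3 $ b $ (1, 1) + t * Y 3 $ b $ (1, 2))))"
  have hX: "hermitian (X \<mu>)" and tr: "trace (copies_deriv model_state \<mu> ** X \<mu>) = 1" for \<mu>
    using feas by (simp_all add: nh_feasible_def unbiased_tuple_def)
  have hY: "hermitian (Y \<mu>)" and trY: "trace (model_deriv \<mu> ** Y \<mu>) = 1" for \<mu>
    using hX tr by (simp_all add: Y_def hermitian_reduce trace_copies_1 trace_copies_deriv_2)
  note entries = unbiased_entries[of Y, OF hY trY]
  have symL: "L \<nu> \<mu> = L \<mu> \<nu>" for \<mu> \<nu>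
    using feas by (simp add: nh_feasible_def)
  have comp: "(A *v u t) $ single b = reduce1 A $ b $ (1, 1) + t * reduce1 A $ b $ (1, 2)" for A t b
    by (simp add: u_def matrix_vector_right_distrib matrix_vector_mult_scaleR_right matrix_vector_axis column_def
        scaleR_conv_of_real[where 'a = complex])
  \<comment> \<open>\<open>outer (u 1)\<close> and \<open>outer (u (- 1))\<close> add up to four
    times the state.\<close>
  have diag: "l 1 \<mu> \<mu> + l (- 1) \<mu> \<mu> = 4 * Re (trace (copies_state model_state ** L \<mu> \<mu>))" for \<mu>
    by (simp add: l_def u_def matrix_vector_right_distrib matrix_vector_mult_scaleR_right matrix_vector_axis
        matrix_vector_mult_diff_distrib inner_diff_left inner_diff_right
        inner_add_left inner_add_right inner_axis' inner_complex_eq trace_copies_1 trace_rho0 column_def)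
  have bound: "(cmod (y t (2, 1)))\<^sup>2 + (cmod (y t (2, 2)))\<^sup>2 \<le> l t 1 1 + l t 2 2 + l t 3 3" if t: "t * t = 1" for t
  proof -
    have tt: "t * (t * r) = r" and ss: "sqrt 2 * (sqrt 2 * r) = 2 * r" for r :: real
      using t by (simp_all flip: mult.assoc)
    \<comment> \<open>The real parts of \<open>c c\<^sup>\<dagger>\<close> and \<open>d d\<^sup>\<dagger>\<close> add up to the identity, so only the diagonal of \<open>l\<close> remains.\<close>
    define c :: "3 \<Rightarrow> complex" where "c = (\<lambda>\<mu>. if \<mu> = 1 then 1 else if \<mu> = 2 then - \<i> * (sqrt 2 / 2) else - \<i> * (sqrt 2 / 2) * t)"
    define d :: "3 \<Rightarrow> complex" where "d = (\<lambda>\<mu>. if \<mu> = 1 then 0 else if \<mu> = 2 then sqrt 2 / 2 else - (sqrt 2 / 2) * t)"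
    have "0 \<le> (norm (\<Sum>\<mu>\<in>UNIV. d \<mu> *s (X \<mu> *v u t)))\<^sup>2" by simp
    also have "\<dots> \<le> (\<Sum>\<mu>\<in>UNIV. \<Sum>\<nu>\<in>UNIV. Re (cnj (d \<mu>) * d \<nu>) * l t \<mu> \<nu>)"
      unfolding l_def by (rule nh_feasible_scaled_norm_le[OF feas])
    also have "\<dots> = l t 2 2 / 2 + l t 3 3 / 2 - t * l t 2 3"
      using t by (simp add: sum_3 d_def l_def symL[of 2 3] algebra_simps tt ss)
    finally have d: "0 \<le> l t 2 2 / 2 + l t 3 3 / 2 - t * l t 2 3" .
    let ?s = "\<Sum>\<mu>\<in>UNIV. c \<mu> *s (X \<mu> *v u t)"
    have "?s $ single b = y t b" for b
      by (simp add: sum_3 c_def comp y_def Y_def algebra_simps)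
    then have "(cmod (y t (2, 1)))\<^sup>2 + (cmod (y t (2, 2)))\<^sup>2 \<le> (norm ?s)\<^sup>2"
      using norm_power2_ge_components[of "single (2, 1)" "single (2, 2)" ?s] by simp
    also have "\<dots> \<le> (\<Sum>\<mu>\<in>UNIV. \<Sum>\<nu>\<in>UNIV. Re (cnj (c \<mu>) * c \<nu>) * l t \<mu> \<nu>)"
      unfolding l_def by (rule nh_feasible_scaled_norm_le[OF feas])
    also have "\<dots> = l t 1 1 + l t 2 2 / 2 + l t 3 3 / 2 + t * l t 2 3"
      using t by (simp add: sum_3 c_def l_def symL[of 2 3] symL[of 1 2] symL[of 1 3] algebra_simps tt ss)
    finally show ?thesis using d by simp
  qed
  \<comment> \<open>Unbiasedness makes the four imaginary parts below, the last with reversed sign,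
    add up to \<open>4 * k\<close>. Their squares are therefore linearised at the common value
    \<open>k\<close>.\<close>
  define k where "k = - (sqrt 2 + 2) / 4"
  have "k * (Im (y 1 (2, 1)) + Im (y 1 (2, 2)) + Im (y (- 1) (2, 1)) - Im (y (- 1) (2, 2))) = 4 * k\<^sup>2"
  proof -
    have "Im (y 1 (2, 1)) + Im (y 1 (2, 2)) + Im (y (- 1) (2, 1)) - Im (y (- 1) (2, 2)) =
        2 * (Im (Y 1 $ (2, 1) $ (1, 1)) + Im (Y 1 $ (2, 2) $ (1, 2)))
        - sqrt 2 * (Re (Y 2 $ (2, 1) $ (1, 1)) + Re (Y 2 $ (2, 2) $ (1, 2)))
        - sqrt 2 * (Re (Y 3 $ (2, 2) $ (1, 1)) + Re (Y 3 $ (2, 1) $ (1, 2)))"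
      by (simp add: y_def algebra_simps)
    also have "\<dots> = 4 * k"
      unfolding entries by (simp add: k_def field_simps)
    finally show ?thesis by (simp add: power2_eq_square)
  qed
  moreover have "2 * k * Im (y 1 (2, 1)) - k\<^sup>2 \<le> (cmod (y 1 (2, 1)))\<^sup>2" "2 * k * Im (y 1 (2, 2)) - k\<^sup>2 \<le> (cmod (y 1 (2, 2)))\<^sup>2"
    "2 * k * Im (y (- 1) (2, 1)) - k\<^sup>2 \<le> (cmod (y (- 1) (2, 1)))\<^sup>2" "2 * (- k) * Im (y (- 1) (2, 2)) - (- k)\<^sup>2 \<le> (cmod (y (- 1) (2, 2)))\<^sup>2"
    by (rule cmod_power2_ge)+
  ultimately have "4 * k\<^sup>2 \<le> l 1 1 1 + l 1 2 2 + l 1 3 3 + (l (- 1) 1 1 + l (- 1) 2 2 + l (- 1) 3 3)"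
    using bound[of 1] bound[of "- 1"] by (simp add: algebra_simps)
  moreover have "4 * k\<^sup>2 = (3 + 2 * sqrt 2) / 2"
    by (simp add: k_def power2_eq_square field_simps)
  ultimately show ?thesis
    using diag[of 1] diag[of 2] diag[of 3] by (simp add: sum_3)
qed

text \<open>The coefficients do not depend on the signs here, so basis vectors with both
  \<open>r\<close>-qubits in ket 0 serve as test vectors. Each of the four has weight 1/4 in the
  state.\<close>

lemma nh_bound_2:
  fixes L :: "3 \<Rightarrow> 3 \<Rightarrow> ((2 \<times> 2)^2) op"
  assumes feas: "nh_feasible (copies_state model_state) (copies_deriv model_state) X L"
  shows "5 / 16 \<le> (\<Sum>\<mu>\<in>UNIV. Re (trace (copies_state model_state ** L \<mu> \<mu>)))"
proof -
  define Y where "Y = (\<lambda>\<mu>. reduce2 (X \<mu>))"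
  have hX: "hermitian (X \<mu>)" and tr: "trace (copies_deriv model_state \<mu> ** X \<mu>) = 1" for \<mu>
    using feas by (simp_all add: nh_feasible_def unbiased_tuple_def)
  have hY: "hermitian (Y \<mu>)" and trY: "trace (model_deriv \<mu> ** Y \<mu>) = 1" for \<mu>
    using hX tr by (simp_all add: Y_def hermitian_reduce trace_copies_1 trace_copies_deriv_2)
  note entries = unbiased_entries[of Y, OF hY trY]
  have symL: "L \<nu> \<mu> = L \<mu> \<nu>" for \<mu> \<nu>
    using feas by (simp add: nh_feasible_def)
  have test: "(cmod (\<Sum>\<mu>\<in>UNIV. c \<mu> * X \<mu> $ j $ i))\<^sup>2 + (cmod (\<Sum>\<mu>\<in>UNIV. c \<mu> * X \<mu> $ k $ i))\<^sup>2
      \<le> (\<Sum>\<mu>\<in>UNIV. \<Sum>\<nu>\<in>UNIV. Re (cnj (c \<mu>) * c \<nu>) * Re (L \<mu> \<nu> $ i $ i))" if "j \<noteq> k" for c i j k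
  proof -
    let ?s = "\<Sum>\<mu>\<in>UNIV. c \<mu> *s (X \<mu> *v axis i 1)"
    have "?s $ m = (\<Sum>\<mu>\<in>UNIV. c \<mu> * X \<mu> $ m $ i)" for m
      by (simp add: matrix_vector_axis column_def)
    then have "(cmod (\<Sum>\<mu>\<in>UNIV. c \<mu> * X \<mu> $ j $ i))\<^sup>2 + (cmod (\<Sum>\<mu>\<in>UNIV. c \<mu> * X \<mu> $ k $ i))\<^sup>2 \<le> (norm ?s)\<^sup>2"
      using norm_power2_ge_components[OF that, of ?s] by (simp only:)
    also have "\<dots> \<le> (\<Sum>\<mu>\<in>UNIV. \<Sum>\<nu>\<in>UNIV. Re (cnj (c \<mu>) * c \<nu>) * (axis i 1 \<bullet> (L \<mu> \<nu> *v axis i 1)))"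
      by (rule nh_feasible_scaled_norm_le[OF feas])
    also have "\<dots> = (\<Sum>\<mu>\<in>UNIV. \<Sum>\<nu>\<in>UNIV. Re (cnj (c \<mu>) * c \<nu>) * Re (L \<mu> \<nu> $ i $ i))"
      by (intro sum.cong refl) (simp add: matrix_vector_axis inner_axis' column_def inner_complex_eq)
    finally show ?thesis .
  qed
  \<comment> \<open>The real part of \<open>z\<close> merges the constraints on \<open>X 1\<close>
    and \<open>X 2\<close>, the former being about imaginary parts, while the cross terms drop out
    of the bound.\<close>
  define z where "z = (\<lambda>j i. \<i> * X 1 $ j $ i + X 2 $ j $ i)"
  define e where "e = (\<lambda>x y :: 2. pair (1 :: 2, x) (1 :: 2, y))"
  define l where "l = (\<lambda>\<mu> x y. Re (L \<mu> \<mu> $ e x y $ e x y))"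
  have z_le: "(cmod (z (pair (2, x') (1, y)) (e x y)))\<^sup>2 + (cmod (z (pair (1, x) (2, y')) (e x y)))\<^sup>2 \<le> l 1 x y + l 2 x y" for x y x' y'
    using test[of "pair (2, x') (1, y)" "pair (1, x) (2, y')" "\<lambda>\<mu>. if \<mu> = 1 then \<i> else if \<mu> = 2 then 1 else 0" "e x y"]
    by (simp add: sum_3 z_def l_def symL[of 1 2])
  have X3_le: "(cmod (X 3 $ pair (2, x') (1, y) $ e x y))\<^sup>2 + (cmod (X 3 $ pair (1, x) (2, y') $ e x y))\<^sup>2 \<le> l 3 x y" for x y x' y'
    using test[of "pair (2, x') (1, y)" "pair (1, x) (2, y')" "\<lambda>\<mu>. if \<mu> = 3 then 1 else 0" "e x y"]
    by (simp add: sum_3 l_def)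
  \<comment> \<open>By unbiasedness the eight real parts of \<open>z\<close> used below add up to
    \<open>2 * sqrt 2\<close>; the squares are linearised at the mean
    \<open>sqrt 2 / 4\<close>.\<close>
  have z_ge: "sqrt 2 / 2 * Re (z j i) - 1 / 8 \<le> (cmod (z j i))\<^sup>2" for j i
    using cmod_power2_ge(1)[of "sqrt 2 / 4" "z j i"] by (simp add: power2_eq_square)
  \<comment> \<open>Here the eight real parts add up to \<open>sqrt 2\<close>, with mean
    \<open>sqrt 2 / 8\<close>.\<close>
  have X3_ge: "sqrt 2 / 4 * Re (X 3 $ j $ i) - 1 / 32 \<le> (cmod (X 3 $ j $ i))\<^sup>2" for j i
    using cmod_power2_ge(1)[of "sqrt 2 / 8" "X 3 $ j $ i"] by (simp add: power2_eq_square)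
  have "1 \<le> (\<Sum>x\<in>UNIV. \<Sum>y\<in>UNIV. l 1 x y + l 2 x y)"
  proof -
    have "sqrt 2 / 2 * (Re (z (pair (2, x) (1, y)) (e x y)) + Re (z (pair (1, x) (2, y)) (e x y))) - 1 / 4 \<le> l 1 x y + l 2 x y" for x y
      using z_le[of x y x y] z_ge[of "pair (2, x) (1, y)" "e x y"] z_ge[of "pair (1, x) (2, y)" "e x y"]
      by (simp add: distrib_left)
    then have "(\<Sum>x\<in>UNIV. \<Sum>y\<in>UNIV. sqrt 2 / 2 * (Re (z (pair (2, x) (1, y)) (e x y)) + Re (z (pair (1, x) (2, y)) (e x y))) - 1 / 4)
        \<le> (\<Sum>x\<in>UNIV. \<Sum>y\<in>UNIV. l 1 x y + l 2 x y)"
      by (intro sum_mono)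
    also have "(\<Sum>x\<in>UNIV. \<Sum>y\<in>UNIV. sqrt 2 / 2 * (Re (z (pair (2, x) (1, y)) (e x y)) + Re (z (pair (1, x) (2, y)) (e x y))) - 1 / 4)
        = sqrt 2 / 2 * (2 * (Re (Y 2 $ (2, 1) $ (1, 1)) + Re (Y 2 $ (2, 2) $ (1, 2)) - (Im (Y 1 $ (2, 1) $ (1, 1)) + Im (Y 1 $ (2, 2) $ (1, 2))))) - 1"
      by (simp add: sum_2 z_def e_def Y_def reduce2_nth algebra_simps add_divide_distrib)
    also have "\<dots> = 1"
      unfolding entries by simp
    finally show ?thesis .
  qed
  moreover have "1 / 4 \<le> (\<Sum>x\<in>UNIV. \<Sum>y\<in>UNIV. l 3 x y)"
  proof -
    \<comment> \<open>The third generator acts by \<open>sigma_x\<close> on \<open>t\<close>, so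
      exciting a copy also flips its \<open>t\<close>-index.\<close>
    define f :: "2 \<Rightarrow> 2" where "f = (\<lambda>x. if x = 1 then 2 else 1)"
    have "sqrt 2 / 4 * (Re (X 3 $ pair (2, f x) (1, y) $ e x y) + Re (X 3 $ pair (1, x) (2, f y) $ e x y)) - 1 / 16 \<le> l 3 x y" for x y
      using X3_le[of "f x" y x "f y"] X3_ge[of "pair (2, f x) (1, y)" "e x y"] X3_ge[of "pair (1, x) (2, f y)" "e x y"]
      by (simp add: distrib_left)
    then have "(\<Sum>x\<in>UNIV. \<Sum>y\<in>UNIV. sqrt 2 / 4 * (Re (X 3 $ pair (2, f x) (1, y) $ e x y) + Re (X 3 $ pair (1, x) (2, f y) $ e x y)) - 1 / 16)
        \<le> (\<Sum>x\<in>UNIV. \<Sum>y\<in>UNIV. l 3 x y)"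
      by (intro sum_mono)
    also have "(\<Sum>x\<in>UNIV. \<Sum>y\<in>UNIV. sqrt 2 / 4 * (Re (X 3 $ pair (2, f x) (1, y) $ e x y) + Re (X 3 $ pair (1, x) (2, f y) $ e x y)) - 1 / 16)
        = sqrt 2 / 4 * (2 * (Re (Y 3 $ (2, 2) $ (1, 1)) + Re (Y 3 $ (2, 1) $ (1, 2)))) - 1 / 4"
      by (simp add: sum_2 f_def e_def Y_def reduce2_nth algebra_simps add_divide_distrib)
    also have "\<dots> = 1 / 4"
      unfolding entries by simp
    finally show ?thesis .
  qed
  ultimately show ?thesis
    by (simp add: sum_3 trace_copies_state_2 l_def e_def sum.distrib field_simps)
qed

subsection \<open>Optimal measurements\<close>

lemma all_single: "(\<forall>i. P i) \<longleftrightarrow> (\<forall>a. P (single a))"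
  by (metis single_collapse)

lemma all_pair: "(\<forall>i. P i) \<longleftrightarrow> (\<forall>a b. P (pair a b))"
  by (metis pair_collapse)

text \<open>For a sign \<open>t\<close>, the amplitudes of the unnormalised eigenvector of
  \<open>sigma_x\<close> with eigenvalue \<open>t\<close>.\<close>

definition phase :: "real \<Rightarrow> 2 \<Rightarrow> complex" where
  "phase t x = (if x = 1 then 1 else complex_of_real t)"

lemma phase_nth [simp]: "phase t 1 = 1" "phase t 2 = complex_of_real t"
  by (simp_all add: phase_def)

lemma sum_signs: "(\<Sum>t\<in>{1, - 1}. f t) = f 1 + f (- 1 :: real)"
  by simp

lemma lessThan_4: "{..<4} = {0, 1, 2, 3 :: nat}"
  by auto

lemma lessThan_5: "{..<5} = {0, 1, 2, 3, 4 :: nat}"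
  by auto

text \<open>The amplitude of ket 1 relative to ket 0. The imaginary pair reads out
  \<open>\<theta>\<^sub>1\<close>, the real pair
  \<open>\<theta>\<^sub>2 + t \<theta>\<^sub>3\<close>.\<close>

definition one_copy_amp :: "nat \<Rightarrow> complex" where
  "one_copy_amp l = (if l = 0 then \<i> else if l = 1 then - \<i> else if l = 2 then 1 else - 1)"

definition one_copy_vec :: "real \<times> nat \<Rightarrow> complex^((2 \<times> 2)^1)" where
  "one_copy_vec = (\<lambda>(t, l). \<chi> i. (if fst (i $ 1) = 1 then 1 else one_copy_amp l) * phase t (snd (i $ 1)) / 2)"

text \<open>With probability \<open>p\<close> for the imaginary pair, the two error contributions
  are \<open>1 / (8 * p)\<close> and \<open>1 / (4 * (1 - p))\<close>; their sum is minimal at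
  \<open>p = sqrt 2 - 1\<close>.\<close>

definition one_copy_weight :: "nat \<Rightarrow> real" where
  "one_copy_weight l = (if l < 2 then sqrt 2 - 1 else 2 - sqrt 2)"

text \<open>Up to sign, every nonzero value is \<open>1 / (2 * sqrt 2 * w)\<close> with
  \<open>w\<close> the weight of its quadrature, as unbiasedness requires.\<close>

definition one_copy_est :: "real \<times> nat \<Rightarrow> real^3" where
  "one_copy_est = (\<lambda>(t, l).
     if l = 0 then vector [- (2 + sqrt 2) / 4, 0, 0]
     else if l = 1 then vector [(2 + sqrt 2) / 4, 0, 0]
     else if l = 2 then vector [0, (sqrt 2 + 1) / 4, t * (sqrt 2 + 1) / 4]
     else vector [0, - (sqrt 2 + 1) / 4, - t * (sqrt 2 + 1) / 4])"

lemma estimation_optimum_1_le: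
  "estimation_optimum (copies_state model_state :: ((2 \<times> 2)^1) op) (copies_deriv model_state) (mat 1)
     \<le> ereal ((3 + 2 * sqrt 2) / 8)"
proof -
  let ?R = "copies_state model_state :: ((2 \<times> 2)^1) op"
  let ?K = "{1, - 1 :: real} \<times> {..<4 :: nat}"
  define M where "M = (\<lambda>k. one_copy_weight (snd k) *\<^sub>R outer (one_copy_vec k))"
  have sum_K: "(\<Sum>k\<in>?K. f k) = (\<Sum>l<4. f (1, l) + f (- 1, l))" for f :: "real \<times> nat \<Rightarrow> 'a::comm_monoid_add"
    by (simp only: sum.cartesian_product' sum_signs sum.distrib)
  have ss: "sqrt 2 * (sqrt 2 * r) = 2 * r" for r :: real
    by (simp flip: mult.assoc)
  note simps = M_def one_copy_weight_def one_copy_vec_def one_copy_amp_def one_copy_est_def lessThan_4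
    scaleR_conv_of_real[where 'a = complex]
  have state: "trace (?R ** M (t, l)) = complex_of_real (one_copy_weight l / 4)" if "t = 1 \<or> t = - 1" for t l
    using that by (auto simp: trace_copies_1 trace_rho0 simps)
  have deriv: "trace (copies_deriv model_state 1 ** M (t, l)) = complex_of_real (- sqrt 2 / 2 * one_copy_weight l * Im (one_copy_amp l))"
    "trace (copies_deriv model_state 2 ** M (t, l)) = complex_of_real (sqrt 2 / 2 * one_copy_weight l * Re (one_copy_amp l))"
    "trace (copies_deriv model_state 3 ** M (t, l)) = complex_of_real (sqrt 2 / 2 * one_copy_weight l * Re (one_copy_amp l) * t)"
    if "t = 1 \<or> t = - 1" for t l
    using that
    by (auto simp: trace_copies_1 trace_model_deriv M_def one_copy_vec_def complex_eq_iff algebra_simps)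
  have "estimation_optimum ?R (copies_deriv model_state) (mat 1)
      \<le> ereal (\<Sum>k\<in>?K. Re (trace (?R ** M k)) * (\<Sum>\<mu>\<in>UNIV. (one_copy_est k $ \<mu>)\<^sup>2))"
  proof (rule estimation_optimum_le)
    show "finite ?K" by simp
    show "psd (M k)" for k
      by (simp add: M_def psd_scaleR psd_outer one_copy_weight_def sqrt_le_D real_le_rsqrt real_le_lsqrt)
    show "(\<Sum>k\<in>?K. M k) = mat 1"
      unfolding sum_K vec_eq_iff all_single split_paired_All forall_2
      by (simp add: simps mat_nth algebra_simps)
    show "(\<Sum>k\<in>?K. trace (?R ** M k) * complex_of_real (one_copy_est k $ \<mu>)) = 0" for \<mu>
      using exhaust_3[of \<mu>] unfolding sum_K
      by (auto simp: state one_copy_est_def lessThan_4 one_copy_weight_def complex_eq_iff field_simps)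
    show "(\<Sum>k\<in>?K. trace (copies_deriv model_state \<nu> ** M k) * complex_of_real (one_copy_est k $ \<mu>)) =
        (if \<mu> = \<nu> then 1 else 0)" for \<mu> \<nu>
      using exhaust_3[of \<mu>] exhaust_3[of \<nu>] unfolding sum_K
      by (auto simp: deriv one_copy_est_def lessThan_4 one_copy_weight_def one_copy_amp_def complex_eq_iff algebra_simps add_divide_distrib ss)
  qed
  also have "(\<Sum>k\<in>?K. Re (trace (?R ** M k)) * (\<Sum>\<mu>\<in>UNIV. (one_copy_est k $ \<mu>)\<^sup>2)) = (3 + 2 * sqrt 2) / 8"
    unfolding sum_K
    by (simp add: state one_copy_est_def lessThan_4 one_copy_weight_def sum_3 power2_eq_square field_simps ss)
  finally show ?thesis .
qed

text \<open>\<open>g $ a $ b\<close> is the amplitude of the \<open>r\<close>-qubits of the two copies. The flag \<open>s\<close> tells whether the two signs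
  agree; the last vector in that case is a dummy, so that both frames have five elements.\<close>

definition two_copy_amp :: "bool \<Rightarrow> nat \<Rightarrow> complex^2^2" where
  "two_copy_amp s l =
    (if s then
      [vector [vector [sqrt 2 / 2, 1 / 2], vector [1 / 2, 0]],
       vector [vector [sqrt 2 / 2, - 1 / 2], vector [- 1 / 2, 0]],
       vector [vector [0, - sqrt 2 / 2], vector [sqrt 2 / 2, 0]],
       vector [vector [0, 0], vector [0, 1]],
       0]
     else
      [vector [vector [1 / 2, - \<i> / 2], vector [- \<i> / 2, 0]],
       vector [vector [1 / 2, \<i> / 2], vector [\<i> / 2, 0]],
       vector [vector [1 / 2, - 1 / 2], vector [1 / 2, 0]],
       vector [vector [1 / 2, 1 / 2], vector [- 1 / 2, 0]],
       vector [vector [0, 0], vector [0, 1]]]) ! l"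

text \<open>\<open>\<theta>\<^sub>3\<close> is estimated in both branches, each supplying half of
  its unbiasedness condition. The estimate is 0 for vectors with \<open>g $ 1 $ 1 = 0\<close>, which
  have probability 0 at the local point.\<close>

definition two_copy_est :: "real \<Rightarrow> real \<Rightarrow> nat \<Rightarrow> real^3" where
  "two_copy_est t1 t2 l =
    (if t1 = t2 then
      [vector [0, 1 / 2, t1 / 4], vector [0, - 1 / 2, - t1 / 4], 0, 0, 0]
     else
      [vector [sqrt 2 / 2, 0, 0], vector [- sqrt 2 / 2, 0, 0],
       vector [0, 0, t1 * sqrt 2 / 4], vector [0, 0, - t1 * sqrt 2 / 4], 0]) ! l"

definition two_copy_vec :: "complex^2^2 \<Rightarrow> real \<Rightarrow> real \<Rightarrow> complex^((2 \<times> 2)^2)" where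
  "two_copy_vec g t1 t2 = (\<chi> i. g $ fst (i $ 1) $ fst (i $ 2) * phase t1 (snd (i $ 1)) * phase t2 (snd (i $ 2)) / 2)"

lemma trace_two_copy_vec:
  assumes "t1 = 1 \<or> t1 = - 1" "t2 = 1 \<or> t2 = - 1"
  shows
  "trace (copies_state model_state ** outer (two_copy_vec g t1 t2)) = g $ 1 $ 1 * cnj (g $ 1 $ 1) / 4"
  "trace (copies_deriv model_state 1 ** outer (two_copy_vec g t1 t2)) = complex_of_real (sqrt 2 / 4) * \<i> *
    ((g $ 2 $ 1 + g $ 1 $ 2) * cnj (g $ 1 $ 1) - cnj (g $ 2 $ 1 + g $ 1 $ 2) * g $ 1 $ 1)"
  "trace (copies_deriv model_state 2 ** outer (two_copy_vec g t1 t2)) = complex_of_real (sqrt 2 / 4) *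
    ((g $ 2 $ 1 + g $ 1 $ 2) * cnj (g $ 1 $ 1) + cnj (g $ 2 $ 1 + g $ 1 $ 2) * g $ 1 $ 1)"
  "trace (copies_deriv model_state 3 ** outer (two_copy_vec g t1 t2)) = complex_of_real (sqrt 2 / 4) *
    ((t1 * g $ 2 $ 1 + t2 * g $ 1 $ 2) * cnj (g $ 1 $ 1) + cnj (t1 * g $ 2 $ 1 + t2 * g $ 1 $ 2) * g $ 1 $ 1)"
  using assms
  by (elim disjE; simp add: trace_copies_state_2 trace_copies_deriv_2 trace_model_deriv reduce2_nth
      two_copy_vec_def sum_2 algebra_simps add_divide_distrib)+

text \<open>For agreeing signs this is an orthonormal basis padded by 0. For differing signs, four
  vectors of squared norm 3/4 form a Parseval frame of the three-dimensional space with at most one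
  excitation, and the last vector completes it.\<close>

lemma two_copy_amp_frame:
  "(\<Sum>l<5. two_copy_amp s l $ r1 $ r2 * cnj (two_copy_amp s l $ q1 $ q2)) = (if r1 = q1 \<and> r2 = q2 then 1 else 0)"
  using exhaust_2[of r1] exhaust_2[of r2] exhaust_2[of q1] exhaust_2[of q2]
  by (cases s) (auto simp: lessThan_5 two_copy_amp_def simp flip: of_real_mult)

lemma phase_orthogonal: "phase 1 x * cnj (phase 1 y) + phase (- 1) x * cnj (phase (- 1) y) = (if x = y then 2 else 0)"
  using exhaust_2[of x] exhaust_2[of y] by auto

text \<open>The frame identity does not depend on the flag, so it factors out of the sum over signs;
  what remains is orthogonality of the phases on each copy.\<close>

lemma two_copy_complete:
  "(\<Sum>t1\<in>{1, - 1}. \<Sum>t2\<in>{1, - 1}. \<Sum>l<5. outer (two_copy_vec (two_copy_amp (t1 = t2) l) t1 t2)) = mat 1"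
proof -
  have "(\<Sum>t1\<in>{1, - 1}. \<Sum>t2\<in>{1, - 1}. \<Sum>l<5. outer (two_copy_vec (two_copy_amp (t1 = t2) l) t1 t2))
      $ pair (r1, x1) (r2, x2) $ pair (q1, y1) (q2, y2) = mat 1 $ pair (r1, x1) (r2, x2) $ pair (q1, y1) (q2, y2)"
    for r1 x1 r2 x2 q1 y1 q2 y2 :: 2
  proof -
    let ?\<delta> = "if r1 = q1 \<and> r2 = q2 then 1 else 0 :: complex"
    have entry: "(\<Sum>l<5. outer (two_copy_vec (two_copy_amp (t1 = t2) l) t1 t2) $ pair (r1, x1) (r2, x2) $ pair (q1, y1) (q2, y2)) =
        (phase t1 x1 * cnj (phase t1 y1)) * (phase t2 x2 * cnj (phase t2 y2)) / 4 * ?\<delta>" for t1 t2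
    proof -
      have "(\<Sum>l<5. outer (two_copy_vec (two_copy_amp (t1 = t2) l) t1 t2) $ pair (r1, x1) (r2, x2) $ pair (q1, y1) (q2, y2)) =
          (phase t1 x1 * cnj (phase t1 y1)) * (phase t2 x2 * cnj (phase t2 y2)) / 4 *
          (\<Sum>l<5. two_copy_amp (t1 = t2) l $ r1 $ r2 * cnj (two_copy_amp (t1 = t2) l $ q1 $ q2))"
        by (simp add: two_copy_vec_def sum_distrib_left mult_ac)
      then show ?thesis by (simp only: two_copy_amp_frame)
    qed
    have "(\<Sum>t1\<in>{1, - 1}. \<Sum>t2\<in>{1, - 1}. \<Sum>l<5. outer (two_copy_vec (two_copy_amp (t1 = t2) l) t1 t2))
        $ pair (r1, x1) (r2, x2) $ pair (q1, y1) (q2, y2) =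
        (phase 1 x1 * cnj (phase 1 y1) + phase (- 1) x1 * cnj (phase (- 1) y1)) *
        (phase 1 x2 * cnj (phase 1 y2) + phase (- 1) x2 * cnj (phase (- 1) y2)) / 4 * ?\<delta>"
      unfolding sum_component unfolding entry unfolding sum_signs by (simp add: algebra_simps add_divide_distrib)
    also have "\<dots> = mat 1 $ pair (r1, x1) (r2, x2) $ pair (q1, y1) (q2, y2)"
      by (simp add: phase_orthogonal mat_nth)
    finally show ?thesis .
  qed
  then show ?thesis
    unfolding vec_eq_iff[of "sum _ _"] vec_eq_iff[of "sum _ _ $ _"] all_pair split_paired_All by blast
qed

text \<open>Agreeing and differing signs contribute 5/32 each to the error.\<close>

lemma estimation_optimum_2_le:
  "estimation_optimum (copies_state model_state :: ((2 \<times> 2)^2) op) (copies_deriv model_state) (mat 1) \<le> ereal (5 / 16)"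
proof -
  let ?R = "copies_state model_state :: ((2 \<times> 2)^2) op"
  let ?K = "{1, - 1 :: real} \<times> {1, - 1 :: real} \<times> {..<5 :: nat}"
  define M where "M = (\<lambda>(t1, t2, l). outer (two_copy_vec (two_copy_amp (t1 = t2) l) t1 t2))"
  define est where "est = (\<lambda>(t1, t2, l). two_copy_est t1 t2 l)"
  have sum_K: "(\<Sum>k\<in>?K. f k) = (\<Sum>t1\<in>{1, - 1}. \<Sum>t2\<in>{1, - 1}. \<Sum>l<5. f (t1, t2, l))"
    for f :: "real \<times> real \<times> nat \<Rightarrow> 'a::comm_monoid_add"
    by (simp only: sum.cartesian_product')
  note simps = M_def est_def sum_signs lessThan_5 trace_two_copy_vec two_copy_amp_def two_copy_est_def
  have "estimation_optimum ?R (copies_deriv model_state) (mat 1)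
      \<le> ereal (\<Sum>k\<in>?K. Re (trace (?R ** M k)) * (\<Sum>\<mu>\<in>UNIV. (est k $ \<mu>)\<^sup>2))"
  proof (rule estimation_optimum_le)
    show "finite ?K" by simp
    show "psd (M k)" for k
      by (simp add: M_def psd_outer split: prod.split)
    show "(\<Sum>k\<in>?K. M k) = mat 1"
      unfolding sum_K M_def prod.case by (rule two_copy_complete)
    show "(\<Sum>k\<in>?K. trace (?R ** M k) * complex_of_real (est k $ \<mu>)) = 0" for \<mu>
      using exhaust_3[of \<mu>] unfolding sum_K by (auto simp: simps)
    show "(\<Sum>k\<in>?K. trace (copies_deriv model_state \<nu> ** M k) * complex_of_real (est k $ \<mu>)) =
        (if \<mu> = \<nu> then 1 else 0)" for \<mu> \<nu>
      using exhaust_3[of \<mu>] exhaust_3[of \<nu>] unfolding sum_K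
      by (auto simp: simps algebra_simps simp flip: of_real_mult)
  qed
  also have "(\<Sum>k\<in>?K. Re (trace (?R ** M k)) * (\<Sum>\<mu>\<in>UNIV. (est k $ \<mu>)\<^sup>2)) = 5 / 16"
    unfolding sum_K by (simp add: simps sum_3 power2_eq_square flip: of_real_mult)
  finally show ?thesis .
qed

subsection \<open>Holevo bound\<close>

lemma psd_dagger_mult: "psd (dagger A ** A)"
proof -
  have "v \<bullet> ((dagger A ** A) *v v) = (A *v v) \<bullet> (A *v v)" for v
    using dagger_adjoint[of A "A *v v" v] by (simp add: inner_commute flip: matrix_vector_mul_assoc)
  moreover have "dagger (dagger A) = A" by (simp add: vec_eq_iff)
  ultimately show ?thesis
    by (simp add: psd_iff_inner hermitian_def dagger_mult)
qed

text \<open>The singular values are \<open>k\<close>, \<open>k\<close>, 0. Thus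
  \<open>M = dagger A ** A\<close> satisfies \<open>M ** M = k\<^sup>2 *\<^sub>R M\<close>, so
  \<open>M\<close> divided by \<open>k\<close> is its own positive square root's closed form, and
  \<open>M\<close> has trace \<open>2 * k\<^sup>2\<close>.\<close>

lemma trace_norm_antisymmetric_3:
  fixes K :: "real^3^3"
  assumes anti: "\<And>i j. K $ j $ i = - K $ i $ j"
  shows "trace_norm (map_matrix complex_of_real K) = 2 * sqrt ((K $ 1 $ 2)\<^sup>2 + (K $ 1 $ 3)\<^sup>2 + (K $ 2 $ 3)\<^sup>2)"
proof -
  define k where "k = sqrt ((K $ 1 $ 2)\<^sup>2 + (K $ 1 $ 3)\<^sup>2 + (K $ 2 $ 3)\<^sup>2)"
  define A where "A = map_matrix complex_of_real K"
  define M where "M = dagger A ** A"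
  have k2: "k\<^sup>2 = (K $ 1 $ 2)\<^sup>2 + (K $ 1 $ 3)\<^sup>2 + (K $ 2 $ 3)\<^sup>2" and k0: "k \<ge> 0"
    by (simp_all add: k_def)
  have diag: "K $ i $ i = 0" for i using anti[of i i] by simp
  have M: "M = map_matrix complex_of_real (\<chi> i j. \<Sum>l\<in>UNIV. K $ l $ i * K $ l $ j)"
    by (simp add: M_def A_def vec_eq_iff matrix_matrix_mult_def)
  have MM: "M ** M = k\<^sup>2 *\<^sub>R M"
    unfolding k2 M
    by (simp add: vec_eq_iff forall_3 matrix_matrix_mult_def sum_3 diag anti[of 1 2] anti[of 1 3] anti[of 2 3]
        scaleR_conv_of_real[where 'a = complex] power2_eq_square algebra_simps)
  have trM: "Re (trace M) = 2 * k\<^sup>2"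
    unfolding k2 M
    by (simp add: trace_def sum_3 diag anti[of 1 2] anti[of 1 3] anti[of 2 3] power2_eq_square)
  \<comment> \<open>The degenerate case: \<open>1 / k\<close> is then 0, and the formula for the
    root still holds because \<open>M\<close> vanishes.\<close>
  have M0: "M = 0" if "k = 0"
  proof -
    have "(K $ 1 $ 2)\<^sup>2 + (K $ 1 $ 3)\<^sup>2 + (K $ 2 $ 3)\<^sup>2 = 0"
      using k2 that by (metis zero_power2)
    then have "K $ 1 $ 2 = 0" "K $ 1 $ 3 = 0" "K $ 2 $ 3 = 0"
      by (simp_all add: add_nonneg_eq_0_iff)
    then show ?thesis
      unfolding M by (simp add: vec_eq_iff forall_3 sum_3 diag anti[of 1 2] anti[of 1 3] anti[of 2 3])
  qed
  have "(1 / k) *\<^sub>R M ** (1 / k) *\<^sub>R M = (1 / k * (1 / k)) *\<^sub>R (M ** M)"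
    by (simp add: vec_eq_iff matrix_matrix_mult_def scaleR_sum_right)
  also have "\<dots> = M"
    using M0 by (cases "k = 0") (simp_all add: MM power2_eq_square)
  finally have "op_sqrt M = (1 / k) *\<^sub>R M"
    using k0 psd_dagger_mult[of A] by (intro op_sqrt_eqI psd_scaleR) (simp_all add: M_def)
  then have "trace_norm A = Re (trace ((1 / k) *\<^sub>R M))"
    by (simp add: trace_norm_def M_def)
  also have "\<dots> = Re (trace M) / k"
    by (simp add: trace_def sum_divide_distrib)
  also have "\<dots> = 2 * k"
    by (simp add: trM power2_eq_square)
  finally show ?thesis by (simp add: A_def k_def)
qed

lemma op_sqrt_mat_1: "op_sqrt (mat 1 :: 'h::finite op) = mat 1"
  by (rule op_sqrt_eqI) (simp_all add: psd_iff_inner hermitian_nth mat_nth)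

text \<open>\<open>Z\<close> is half the sum of the Gram matrices of the columns of the
  \<open>X \<mu>\<close> on the support of \<open>rho0\<close>. Hence it is Hermitian and its
  imaginary part antisymmetric.\<close>

lemma holevo_objective_mat_1:
  fixes X :: "3 \<Rightarrow> (2 \<times> 2) op"
  assumes herm: "\<And>\<mu>. hermitian (X \<mu>)"
  defines "Z \<equiv> holevo_Z rho0 X"
  shows "holevo_objective rho0 (mat 1) X = Re (Z $ 1 $ 1) + Re (Z $ 2 $ 2) + Re (Z $ 3 $ 3) +
    2 * sqrt ((Im (Z $ 1 $ 2))\<^sup>2 + (Im (Z $ 1 $ 3))\<^sup>2 + (Im (Z $ 2 $ 3))\<^sup>2)"
    and "Z $ \<mu> $ \<nu> = (\<Sum>k\<in>UNIV. cnj (X \<mu> $ k $ (1, 1)) * X \<nu> $ k $ (1, 1) + cnj (X \<mu> $ k $ (1, 2)) * X \<nu> $ k $ (1, 2)) / 2"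
proof -
  have Z: "Z $ \<mu> $ \<nu> = (\<Sum>k\<in>UNIV. cnj (X \<mu> $ k $ (1, 1)) * X \<nu> $ k $ (1, 1) + cnj (X \<mu> $ k $ (1, 2)) * X \<nu> $ k $ (1, 2)) / 2" for \<mu> \<nu>
  proof -
    have "Z $ \<mu> $ \<nu> = trace (rho0 ** (X \<mu> ** X \<nu>))"
      by (simp add: Z_def holevo_Z_def matrix_mul_assoc)
    then show ?thesis
      by (simp add: trace_rho0 matrix_matrix_mult_def[of "X \<mu>"] sum.distrib hermitianD[OF herm])
  qed
  then show "Z $ \<mu> $ \<nu> = (\<Sum>k\<in>UNIV. cnj (X \<mu> $ k $ (1, 1)) * X \<nu> $ k $ (1, 1) + cnj (X \<mu> $ k $ (1, 2)) * X \<nu> $ k $ (1, 2)) / 2" .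
  have adj: "Z $ \<nu> $ \<mu> = cnj (Z $ \<mu> $ \<nu>)" for \<mu> \<nu>
    unfolding Z by (simp add: cnj_sum mult.commute)
  have "map_matrix Im Z $ \<nu> $ \<mu> = - map_matrix Im Z $ \<mu> $ \<nu>" for \<mu> \<nu>
    unfolding nth_map_matrix adj[where \<nu> = \<nu> and \<mu> = \<mu>] by (rule cnj.simps(2))
  from trace_norm_antisymmetric_3[OF this]
  have "trace_norm (map_matrix complex_of_real (map_matrix Im Z)) =
      2 * sqrt ((Im (Z $ 1 $ 2))\<^sup>2 + (Im (Z $ 1 $ 3))\<^sup>2 + (Im (Z $ 2 $ 3))\<^sup>2)"
    by (simp only: nth_map_matrix)
  moreover have "map_matrix complex_of_real (mat 1) = (mat 1 :: 3 op)"
    by (simp add: vec_eq_iff mat_nth)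
  ultimately show "holevo_objective rho0 (mat 1) X = Re (Z $ 1 $ 1) + Re (Z $ 2 $ 2) + Re (Z $ 3 $ 3) +
    2 * sqrt ((Im (Z $ 1 $ 2))\<^sup>2 + (Im (Z $ 1 $ 3))\<^sup>2 + (Im (Z $ 2 $ 3))\<^sup>2)"
    by (simp add: holevo_objective_def op_sqrt_mat_1 trace_def[where 'a = real] sum_3 flip: Z_def)
qed

text \<open>Keeping only \<open>Im (Z $ 1 $ 2)\<close> in the trace norm completes the first two
  diagonal entries to squared norms of columns of \<open>\<i> X\<^sub>1 + X\<^sub>2\<close>. These
  contribute 1/2, and \<open>X 3\<close> contributes 1/8.\<close>

lemma holevo_objective_ge:
  fixes X :: "3 \<Rightarrow> (2 \<times> 2) op"
  assumes "unbiased_tuple rho0 model_deriv X"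
  shows "5 / 8 \<le> holevo_objective rho0 (mat 1) X"
proof -
  define Z where "Z = holevo_Z rho0 X"
  have herm: "hermitian (X \<mu>)" and tr: "trace (model_deriv \<mu> ** X \<mu>) = 1" for \<mu>
    using assms by (simp_all add: unbiased_tuple_def)
  note entries = unbiased_entries[of X, OF herm tr]
  note Z = holevo_objective_mat_1(2)[of X, OF herm, folded Z_def]
  define y where "y = (\<lambda>k x. \<i> * X 1 $ k $ (1, x) + X 2 $ k $ (1, x))"
  have cmod_sum: "(cmod (\<i> * a + b))\<^sup>2 = Re (cnj a * a) + Re (cnj b * b) + 2 * Im (cnj a * b)" for a b
    unfolding cmod_power2 by (simp add: power2_eq_square algebra_simps)
  have "Re (Z $ 1 $ 1) + Re (Z $ 2 $ 2) + 2 * Im (Z $ 1 $ 2) = (\<Sum>k\<in>UNIV. (cmod (y k 1))\<^sup>2 + (cmod (y k 2))\<^sup>2) / 2"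
    unfolding Z y_def cmod_sum
    by (simp only: Re_divide_numeral Im_divide_numeral Re_sum Im_sum plus_complex.sel sum.distrib sum_distrib_left[symmetric])
       (simp add: field_simps)
  also have "\<dots> \<ge> ((cmod (y (2, 1) 1))\<^sup>2 + (cmod (y (2, 2) 2))\<^sup>2) / 2"
    by (simp add: sum_UNIV_prod sum_2)
  finally have "((cmod (y (2, 1) 1))\<^sup>2 + (cmod (y (2, 2) 2))\<^sup>2) / 2 \<le> Re (Z $ 1 $ 1) + Re (Z $ 2 $ 2) + 2 * Im (Z $ 1 $ 2)" .
  moreover have "Re (y (2, 1) 1) + Re (y (2, 2) 2) = sqrt 2"
    using entries by (simp add: y_def)
  then have "sqrt 2 * (Re (y (2, 1) 1) + Re (y (2, 2) 2)) = 2"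
    by simp
  \<comment> \<open>The squares are linearised at \<open>sqrt 2 / 2\<close>, the mean of the two
    real parts; the same device with mean \<open>sqrt 2 / 4\<close> handles \<open>X 3\<close>
    below.\<close>
  then have "1 \<le> (cmod (y (2, 1) 1))\<^sup>2 + (cmod (y (2, 2) 2))\<^sup>2"
    using cmod_power2_ge(1)[of "sqrt 2 / 2" "y (2, 1) 1"] cmod_power2_ge(1)[of "sqrt 2 / 2" "y (2, 2) 2"]
    by (simp add: power2_eq_square distrib_left)
  moreover have "((cmod (X 3 $ (2, 2) $ (1, 1)))\<^sup>2 + (cmod (X 3 $ (2, 1) $ (1, 2)))\<^sup>2) / 2 \<le> Re (Z $ 3 $ 3)"
  proof -
    have "Re (Z $ 3 $ 3) = (\<Sum>k\<in>UNIV. (cmod (X 3 $ k $ (1, 1)))\<^sup>2 + (cmod (X 3 $ k $ (1, 2)))\<^sup>2) / 2"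
      unfolding Z cmod_power2 by (simp add: power2_eq_square)
    then show ?thesis by (simp add: sum_UNIV_prod sum_2)
  qed
  moreover have "1 / 4 \<le> (cmod (X 3 $ (2, 2) $ (1, 1)))\<^sup>2 + (cmod (X 3 $ (2, 1) $ (1, 2)))\<^sup>2"
  proof -
    have "sqrt 2 * (Re (X 3 $ (2, 2) $ (1, 1)) + Re (X 3 $ (2, 1) $ (1, 2))) = 1"
      unfolding entries by simp
    then show ?thesis
      using cmod_power2_ge(1)[of "sqrt 2 / 4" "X 3 $ (2, 2) $ (1, 1)"] cmod_power2_ge(1)[of "sqrt 2 / 4" "X 3 $ (2, 1) $ (1, 2)"]
      by (simp add: power2_eq_square distrib_left)
  qed
  moreover have "Im (Z $ 1 $ 2) \<le> sqrt ((Im (Z $ 1 $ 2))\<^sup>2 + (Im (Z $ 1 $ 3))\<^sup>2 + (Im (Z $ 2 $ 3))\<^sup>2)"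
    by (rule real_le_rsqrt) simp
  ultimately show ?thesis
    unfolding holevo_objective_mat_1(1)[of X, OF herm, folded Z_def] by argo
qed

lemma holevo_bound_model_state: "holevo_bound model_state (mat 1) = ereal (5 / 8)"
proof -
  \<comment> \<open>The derivatives are mutually trace-orthogonal with squared Hilbert-Schmidt norm
    2, so halving them gives an unbiased tuple; it attains the minimum.\<close>
  define X where "X = (\<lambda>\<mu>. (1 / 2) *\<^sub>R model_deriv \<mu>)"
  have "hermitian (model_deriv \<mu>)" for \<mu>
    by (simp add: model_deriv_def hermitian_nth forall_2 mat_nth)
  then have herm: "hermitian (X \<mu>)" for \<mu>
    by (simp add: X_def hermitian_nth)
  have model_deriv_nth: "model_deriv \<mu> $ i $ j = complex_of_real (sqrt 2 / 2) * (if \<mu> = 1 then - sigma_y $ fst i $ fst j * mat 1 $ snd i $ snd j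
      else sigma_x $ fst i $ fst j * (if \<mu> = 2 then mat 1 else sigma_x) $ snd i $ snd j)" for \<mu> i j
    by (simp add: model_deriv_def)
  have X_nth: "X \<mu> $ i $ j = model_deriv \<mu> $ i $ j / 2" for \<mu> i j
    by (simp add: X_def scaleR_conv_of_real[where 'a = complex])
  have css: "complex_of_real (sqrt 2) * (complex_of_real (sqrt 2) * r) = 2 * r" "complex_of_real (sqrt 2) * complex_of_real (sqrt 2) = 2" for r
    by (simp_all flip: mult.assoc of_real_mult)
  have unb: "unbiased_tuple rho0 model_deriv X"
  proof -
    have "trace (model_deriv \<nu> ** X \<mu>) = (if \<mu> = \<nu> then 1 else 0)" for \<mu> \<nu>
      using exhaust_3[of \<mu>] exhaust_3[of \<nu>]
      by (auto simp: trace_model_deriv X_nth model_deriv_nth mat_nth algebra_simps css)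
    moreover have "trace (rho0 ** X \<mu>) = 0" for \<mu>
      by (simp add: trace_rho0 X_nth model_deriv_nth)
    ultimately show ?thesis using herm by (simp add: unbiased_tuple_def)
  qed
  have "Im (holevo_Z rho0 X $ 1 $ 2) = 1 / 8"
    "Im (holevo_Z rho0 X $ 1 $ 3) = 0" "Im (holevo_Z rho0 X $ 2 $ 3) = 0"
    "Re (holevo_Z rho0 X $ \<mu> $ \<mu>) = 1 / 8" for \<mu>
    unfolding holevo_objective_mat_1(2)[of X, OF herm]
    by (simp_all add: X_nth model_deriv_nth sum_UNIV_prod sum_2 mat_nth)
  then have "holevo_objective rho0 (mat 1) X = 5 / 8"
    unfolding holevo_objective_mat_1(1)[of X, OF herm] by simp
  then have "ereal (5 / 8) = ereal (holevo_objective rho0 (mat 1) X)"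
    by simp
  then have "(LEAST c. \<exists>X. unbiased_tuple rho0 model_deriv X \<and> c = ereal (holevo_objective rho0 (mat 1) X)) = ereal (5 / 8)"
    using unb holevo_objective_ge by (intro Least_equality exI[of _ X]) auto
  then show ?thesis
    by (simp add: holevo_bound_def model_state_0 partial_at_0_model_state)
qed

section \<open>Combination of the bounds\<close>

lemma nh_optimum_ge:
  assumes "\<And>X L. nh_feasible R D X L \<Longrightarrow> b \<le> (\<Sum>\<mu>\<in>UNIV. Re (trace (R ** L \<mu> \<mu>)))"
  shows "ereal b \<le> nh_optimum R D (mat 1)"
proof -
  have "(\<Sum>\<mu>\<in>UNIV. \<Sum>\<nu>\<in>UNIV. (mat 1 :: real^'a^'a) $ \<mu> $ \<nu> * Re (trace (R ** L \<mu> \<nu>))) = (\<Sum>\<mu>\<in>UNIV. Re (trace (R ** L \<mu> \<mu>)))" for L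
    by (simp add: mat_nth if_distrib if_distribR cong: if_cong)
  then show ?thesis
    unfolding nh_optimum_def using assms by (auto intro!: Inf_greatest)
qed

theorem mainTheorem2:
  defines "W \<equiv> mat 1 :: real^3^3"
  shows "nagaoka_hayashi_bound TYPE(1) model_state W = ereal ((3 + 2 * sqrt 2) / 8)
       \<and> finite_copy_optimum TYPE(1) model_state W = ereal ((3 + 2 * sqrt 2) / 8)
       \<and> nagaoka_hayashi_bound TYPE(2) model_state W = ereal (5 / 8)
       \<and> finite_copy_optimum TYPE(2) model_state W = ereal (5 / 8)
       \<and> holevo_bound model_state W = ereal (5 / 8)
       \<and> holevo_bound model_state W < nagaoka_hayashi_bound TYPE(1) model_state W
       \<and> nagaoka_hayashi_bound TYPE(2) model_state W = holevo_bound model_state W"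
proof -
  let ?R1 = "copies_state model_state :: ((2 \<times> 2)^1) op" and ?R2 = "copies_state model_state :: ((2 \<times> 2)^2) op"
  have "ereal ((3 + 2 * sqrt 2) / 8) \<le> nh_optimum ?R1 (copies_deriv model_state) W"
    "ereal (5 / 16) \<le> nh_optimum ?R2 (copies_deriv model_state) W"
    unfolding W_def by (intro nh_optimum_ge nh_bound_1 nh_bound_2; assumption)+
  \<comment> \<open>Each lower bound on the Nagaoka-Hayashi optimum equals the error of the explicit
    measurement, and the estimation optimum is squeezed between them.\<close>
  then have opt: "nh_optimum ?R1 (copies_deriv model_state) W = ereal ((3 + 2 * sqrt 2) / 8)"
    "estimation_optimum ?R1 (copies_deriv model_state) W = ereal ((3 + 2 * sqrt 2) / 8)"
    "nh_optimum ?R2 (copies_deriv model_state) W = ereal (5 / 16)"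
    "estimation_optimum ?R2 (copies_deriv model_state) W = ereal (5 / 16)"
    using nh_optimum_le_estimation_optimum[of ?R1 "copies_deriv model_state" W]
      nh_optimum_le_estimation_optimum[of ?R2 "copies_deriv model_state" W]
      estimation_optimum_1_le estimation_optimum_2_le
    by (auto simp: W_def intro!: order_antisym elim: order_trans)
  have "1 \<le> sqrt 2" by simp
  then have "(5 :: real) / 8 < (3 + 2 * sqrt 2) / 8" by (simp add: real_less_rsqrt)
  then show ?thesis
    using holevo_bound_model_state
    by (simp add: nagaoka_hayashi_bound_def finite_copy_optimum_def opt W_def[symmetric])
qed

end
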